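(* Let $\Gamma$ be a countable a-TTT-menable group. Then $\Gamma$ admits a proper uniformly Lipschitz affine action on a subspace of an $L^1$ space; that is, there exist a measure space $(\Omega,\mu)$, a closed subspace $E\subseteq L^1(\Omega,\mu)$, and a proper uniformly Lipschitz affine action of $\Gamma$ on $E$.
   Context: Groups are discrete. a-TTT-menability. Let $\mathcal{H}$ be a complex Hilbert space with unitary group $\mathcal{U}(\mathcal{H})$. A map $b:\Gamma\to\mathcal{H}$ is a wq-cocycle if there is a map (not necessarily a homomorphism) $\pi:\Gamma\to\mathcal{U}(\mathcal{H})$ such that $\sup_{s,t\in\Gamma}\lVert b(st)-\pi(s)b(t)-b(s)\rVert<\infty$. It is proper if $\lVert b(s)\rVert\to\infty$ as $s\to\infty$, i.e. for every $R>0$ the set $\{s\in\Gamma : \lVert b(s)\rVert\leq R\}$ is finite. The group $\Gamma$ is a-TTT-menable if it admits a proper wq-cocycle into some complex Hilbert space. Affine actions. $L^1(\Omega,\mu)$ is the real Banach space of integrable real-valued functions. An affine action $\sigma$ of $\Gamma$ on a real Banach space $E$ is given by a group homomorphism $\pi:\Gamma\to\operatorname{GL}(E)$ (invertible bounded linear operators) and a map $b:\Gamma\to E$ satisfying $b(st)=\pi(s)b(t)+b(s)$ for all $s,t\in\Gamma$, through $\sigma(s)v=\pi(s)v+b(s)$. It is uniformly Lipschitz if there is $C\ge1$ such that $\lVert\sigma(s)v-\sigma(s)w\rVert\leq C\lVert v-w\rVert$ for all $s\in\Gamma$, $v,w\in E$. It is proper if for every $v\in E$ and $R>0$ the set $\{s\in\Gamma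 : \lVert\sigma(s)v-v\rVert\le R\}$ is finite. *)

theory Defs
  imports "HOL-Analysis.Analysis" "HOL-Algebra.Bij"
begin

section \<open>Complex Hilbert spaces\<close>

text \<open>
  A complex inner product is added on top of the library's class of real inner product
  spaces; the axiom \<open>Re_cinner\<close> says that norm and topology are those of the complex inner
  product (which is positive definite because its real part is). The inner product is linear
  in the first argument.
\<close>

class complex_inner = real_inner +
  fixes scaleC :: "complex \<Rightarrow> 'a \<Rightarrow> 'a"  (infixr \<open>*\<^sub>C\<close> 75)
    and cinner :: "'a \<Rightarrow> 'a \<Rightarrow> complex"
  assumes scaleC_add_right: "c *\<^sub>C (x + y) = c *\<^sub>C x + c *\<^sub>C y"
    and scaleC_add_left: "(c + d) *\<^sub>C x = c *\<^sub>C x + d *\<^sub>C x"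
    and scaleC_scaleC: "c *\<^sub>C d *\<^sub>C x = (c * d) *\<^sub>C x"
    and scaleC_of_real: "complex_of_real r *\<^sub>C x = r *\<^sub>R x"
    and cinner_commute: "cinner x y = cnj (cinner y x)"
    and cinner_add_left: "cinner (x + y) z = cinner x z + cinner y z"
    and cinner_scaleC_left: "cinner (c *\<^sub>C x) y = c * cinner x y"
    and Re_cinner: "Re (cinner x y) = inner x y"

class complex_hilbert = complex_inner + complete_space

lemma cinner_self: "cinner x x = complex_of_real ((norm x)\<^sup>2)"
proof (rule complex_eqI)
  show "Re (cinner x x) = Re (complex_of_real ((norm x)\<^sup>2))"
    by (simp add: Re_cinner power2_norm_eq_inner)
  have "Im (cinner x x) = - Im (cinner x x)"
    by (subst cinner_commute) simp
  then show "Im (cinner x x) = Im (complex_of_real ((norm x)\<^sup>2))"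
    by simp
qed

instantiation complex :: complex_hilbert
begin

definition scaleC_complex :: "complex \<Rightarrow> complex \<Rightarrow> complex"
  where "scaleC_complex c x = c * x"

definition cinner_complex :: "complex \<Rightarrow> complex \<Rightarrow> complex"
  where "cinner_complex x y = x * cnj y"

instance
  by standard
    (auto simp: scaleC_complex_def cinner_complex_def algebra_simps scaleR_conv_of_real
      inner_complex_def)

end

definition unitary_op :: "('h::complex_inner \<Rightarrow> 'h) \<Rightarrow> bool" where
  "unitary_op U \<longleftrightarrow>
    (\<forall>x y. U (x + y) = U x + U y) \<and> (\<forall>c x. U (c *\<^sub>C x) = c *\<^sub>C U x) \<and>
    (\<forall>x y. cinner (U x) (U y) = cinner x y) \<and> surj U"


section \<open>a-TTT-menability\<close>

definition wq_cocycle :: "('g, 'm) monoid_scheme \<Rightarrow> ('g \<Rightarrow> 'h::complex_hilbert) \<Rightarrow> bool" where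
  "wq_cocycle G b \<longleftrightarrow>
    (\<exists>\<pi> :: 'g \<Rightarrow> 'h \<Rightarrow> 'h. (\<forall>s\<in>carrier G. unitary_op (\<pi> s)) \<and>
      bdd_above ((\<lambda>(s, t). norm (b (s \<otimes>\<^bsub>G\<^esub> t) - \<pi> s (b t) - b s)) ` (carrier G \<times> carrier G)))"

definition proper_map_on_group :: "('g, 'm) monoid_scheme \<Rightarrow> ('g \<Rightarrow> 'h::real_normed_vector) \<Rightarrow> bool"
  where "proper_map_on_group G b \<longleftrightarrow> (\<forall>R>0. finite {s \<in> carrier G. norm (b s) \<le> R})"

text \<open>
  A formula cannot quantify over types, so the Hilbert space is a type parameter. In a theorem
  assuming \<open>a_TTT_menable TYPE('h) G\<close> with \<open>'h\<close> a type variable, the Hilbert space is arbitrary.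
\<close>

definition a_TTT_menable :: "'h::complex_hilbert itself \<Rightarrow> ('g, 'm) monoid_scheme \<Rightarrow> bool" where
  "a_TTT_menable H G \<longleftrightarrow> (\<exists>b :: 'g \<Rightarrow> 'h. wq_cocycle G b \<and> proper_map_on_group G b)"


section \<open>Normed spaces with explicit carrier\<close>

text \<open>
  \<open>L\<^sup>1(\<Omega>, \<mu>)\<close> depends on the measure, and its closed subspaces are quantified over, so these
  spaces cannot be types.
\<close>

record 'v normed_space = "'v partial_object" +
  vadd :: "'v \<Rightarrow> 'v \<Rightarrow> 'v"
  vscale :: "real \<Rightarrow> 'v \<Rightarrow> 'v"
  vzero :: 'v
  vnorm :: "'v \<Rightarrow> real"

definition vdist :: "('v, 'm) normed_space_scheme \<Rightarrow> 'v \<Rightarrow> 'v \<Rightarrow> real" where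
  "vdist V v w = vnorm V (vadd V v (vscale V (-1) w))"

definition closed_subspace :: "'v set \<Rightarrow> ('v, 'm) normed_space_scheme \<Rightarrow> bool" where
  "closed_subspace E V \<longleftrightarrow>
    E \<subseteq> carrier V \<and> vzero V \<in> E \<and>
    (\<forall>v\<in>E. \<forall>w\<in>E. vadd V v w \<in> E) \<and> (\<forall>r. \<forall>v\<in>E. vscale V r v \<in> E) \<and>
    (\<forall>v\<in>carrier V. (\<forall>e>0. \<exists>w\<in>E. vdist V w v < e) \<longrightarrow> v \<in> E)"

definition bounded_linear_op :: "('v, 'm) normed_space_scheme \<Rightarrow> ('v \<Rightarrow> 'v) \<Rightarrow> bool" where
  "bounded_linear_op V T \<longleftrightarrow>
    T \<in> carrier V \<rightarrow> carrier V \<and>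
    (\<forall>v\<in>carrier V. \<forall>w\<in>carrier V. T (vadd V v w) = vadd V (T v) (T w)) \<and>
    (\<forall>r. \<forall>v\<in>carrier V. T (vscale V r v) = vscale V r (T v)) \<and>
    (\<exists>K. \<forall>v\<in>carrier V. vnorm V (T v) \<le> K * vnorm V v)"

definition GL :: "('v, 'm) normed_space_scheme \<Rightarrow> ('v \<Rightarrow> 'v) monoid" where
  "GL V = BijGroup (carrier V)
    \<lparr>carrier := {T \<in> Bij (carrier V). bounded_linear_op V T \<and>
                   bounded_linear_op V (inv_into (carrier V) T)}\<rparr>"


section \<open>Affine actions\<close>

definition affine_action ::
    "('g, 'm) monoid_scheme \<Rightarrow> ('v, 'n) normed_space_scheme \<Rightarrow> ('g \<Rightarrow> 'v \<Rightarrow> 'v) \<Rightarrow> bool" where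
  "affine_action G V \<sigma> \<longleftrightarrow>
    (\<exists>\<pi> \<in> hom G (GL V). \<exists>b \<in> carrier G \<rightarrow> carrier V.
      (\<forall>s\<in>carrier G. \<forall>t\<in>carrier G. b (s \<otimes>\<^bsub>G\<^esub> t) = vadd V (\<pi> s (b t)) (b s)) \<and>
      (\<forall>s\<in>carrier G. \<forall>v\<in>carrier V. \<sigma> s v = vadd V (\<pi> s v) (b s)))"

definition uniformly_Lipschitz_action ::
    "('g, 'm) monoid_scheme \<Rightarrow> ('v, 'n) normed_space_scheme \<Rightarrow> ('g \<Rightarrow> 'v \<Rightarrow> 'v) \<Rightarrow> bool" where
  "uniformly_Lipschitz_action G V \<sigma> \<longleftrightarrow>
    (\<exists>C\<ge>1. \<forall>s\<in>carrier G. \<forall>v\<in>carrier V. \<forall>w\<in>carrier V.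
      vdist V (\<sigma> s v) (\<sigma> s w) \<le> C * vdist V v w)"

definition proper_action ::
    "('g, 'm) monoid_scheme \<Rightarrow> ('v, 'n) normed_space_scheme \<Rightarrow> ('g \<Rightarrow> 'v \<Rightarrow> 'v) \<Rightarrow> bool" where
  "proper_action G V \<sigma> \<longleftrightarrow>
    (\<forall>v\<in>carrier V. \<forall>R>0. finite {s \<in> carrier G. vdist V (\<sigma> s v) v \<le> R})"


section \<open>The space of integrable functions modulo equality almost everywhere\<close>

definition ae_eq :: "'w measure \<Rightarrow> (('w \<Rightarrow> real) \<times> ('w \<Rightarrow> real)) set" where
  "ae_eq M = {(f, g). integrable M f \<and> integrable M g \<and> (AE x in M. f x = g x)}"

definition L1 :: "'w measure \<Rightarrow> ('w \<Rightarrow> real) set normed_space" where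
  "L1 M =
    \<lparr>carrier = {f. integrable M f} // ae_eq M,
     vadd = (\<lambda>X Y. \<Union>f\<in>X. \<Union>g\<in>Y. ae_eq M `` {\<lambda>x. f x + g x}),
     vscale = (\<lambda>r X. \<Union>f\<in>X. ae_eq M `` {\<lambda>x. r * f x}),
     vzero = ae_eq M `` {\<lambda>x. 0},
     vnorm = (\<lambda>X. the_elem ((\<lambda>f. \<integral>x. \<bar>f x\<bar> \<partial>M) ` X))\<rparr>"

text \<open>
  To assert that a measure space exists one has to name a type containing \<open>\<Omega>\<close>. For actions of a
  countable group any type of cardinality at least the continuum will do, e.g. \<open>real\<close> (with an
  arbitrary \<open>\<sigma>\<close>-algebra and measure): \<open>E\<close> may be replaced by the closed linear span of the values
  of the cocycle, which is invariant and separable, hence embeds isometrically into \<open>L\<^sup>1\<close> of a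
  measure on the real line.
\<close>

lemma equiv_ae_eq: "equiv {f. integrable M f} (ae_eq M)"
  by (rule equivI) (auto simp: ae_eq_def refl_on_def sym_def trans_def elim: eventually_elim2)

lemma L1_vadd_class:
  assumes "integrable M f" "integrable M g"
  shows "vadd (L1 M) (ae_eq M `` {f}) (ae_eq M `` {g}) = ae_eq M `` {\<lambda>x. f x + g x}"
proof -
  have "congruent2 (ae_eq M) (ae_eq M) (\<lambda>f g. ae_eq M `` {\<lambda>x. f x + g x})"
    by (rule congruent2I', rule equiv_class_eq[OF equiv_ae_eq])
      (auto simp: ae_eq_def elim: eventually_elim2)
  then show ?thesis
    using UN_equiv_class2[OF equiv_ae_eq equiv_ae_eq, of M M _ f g] assms
    by (simp add: L1_def)
qed

lemma L1_vscale_class: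
  assumes "integrable M f"
  shows "vscale (L1 M) r (ae_eq M `` {f}) = ae_eq M `` {\<lambda>x. r * f x}"
proof -
  have "congruent (ae_eq M) (\<lambda>f. ae_eq M `` {\<lambda>x. r * f x})"
    by (rule congruentI, rule equiv_class_eq[OF equiv_ae_eq])
      (auto simp: ae_eq_def elim: eventually_mono)
  then show ?thesis
    using UN_equiv_class[OF equiv_ae_eq, of M _ f] assms by (simp add: L1_def)
qed

lemma L1_vnorm_class:
  assumes "integrable M f"
  shows "vnorm (L1 M) (ae_eq M `` {f}) = (\<integral>x. \<bar>f x\<bar> \<partial>M)"
proof -
  have "(\<integral>x. \<bar>g x\<bar> \<partial>M) = (\<integral>x. \<bar>f x\<bar> \<partial>M)" if "g \<in> ae_eq M `` {f}" for g
    using that by (intro integral_cong_AE) (auto simp: ae_eq_def elim: eventually_mono)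
  moreover have "f \<in> ae_eq M `` {f}"
    using assms by (simp add: ae_eq_def)
  ultimately have "(\<lambda>g. \<integral>x. \<bar>g x\<bar> \<partial>M) ` (ae_eq M `` {f}) = {\<integral>x. \<bar>f x\<bar> \<partial>M}"
    by blast
  then show ?thesis
    by (simp add: L1_def)
qed

end

theory Submission
  imports Defs
begin

text \<open>
  Let \<open>b\<close> be a proper wq-cocycle with unitaries \<open>\<pi>(s)\<close> and defect at most \<open>C\<close>. If \<open>f\<close> is finitely
  supported on the group with \<open>\<Sum> f = 0\<close>, then the contributions of \<open>b(s)\<close> to \<open>\<Sum> f(x) b(sx)\<close> cancel,
  so this sum differs from \<open>\<pi>(s) (\<Sum> f(x) b(x))\<close> by at most \<open>C \<Sum> \<bar>f\<bar>\<close>, although \<open>\<pi>\<close> is not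
  multiplicative. Hence left translations are uniformly bounded on these \<open>f\<close> for the norm
  \<open>\<parallel>\<Sum> f(x) b(x)\<parallel> + \<Sum> \<bar>f\<bar>\<close>. The cocycle \<open>s \<mapsto> \<delta>\<^sub>s - \<delta>\<^sub>1\<close> is proper for this norm because \<open>b\<close> is.
  Up to equivalence the norm is induced from \<open>L\<^sup>1(\<real>)\<close>: the Hilbert space part is represented by
  Rademacher sums on the unit interval (Khintchine's inequality), the other part by indicator
  functions of disjoint intervals outside it.
\<close>

section \<open>Gram-Schmidt orthogonalisation of a sequence\<close>

text \<open>
  The vectors are not normalised and may vanish; a vanishing vector contributes nothing to later
  ones, whatever the value of its coefficient \<open>0 / 0\<close>.
\<close>

fun gram_schmidt :: "(nat \<Rightarrow> 'a::real_inner) \<Rightarrow> nat \<Rightarrow> 'a" where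
  "gram_schmidt v n =
    v n - (\<Sum>k<n. (v n \<bullet> gram_schmidt v k / (gram_schmidt v k \<bullet> gram_schmidt v k)) *\<^sub>R gram_schmidt v k)"

declare gram_schmidt.simps [simp del]

lemma gram_schmidt_orthogonal_less:
  "j < n \<Longrightarrow> gram_schmidt v n \<bullet> gram_schmidt v j = 0"
proof (induction n arbitrary: j rule: less_induct)
  case (less n)
  let ?u = "gram_schmidt v"
  have *: "?u k \<bullet> ?u j = 0" if "k < n" "k \<noteq> j" for k
  proof (cases "j < k")
    case True
    then show ?thesis using less.IH that by blast
  next
    case False
    then have "?u j \<bullet> ?u k = 0" using less.IH[of j k] less.prems that by auto
    then show ?thesis by (simp add: inner_commute)
  qed
  have "?u n \<bullet> ?u j = v n \<bullet> ?u j - (\<Sum>k<n. (v n \<bullet> ?u k / (?u k \<bullet> ?u k)) * (?u k \<bullet> ?u j))"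
    by (subst gram_schmidt.simps) (simp add: inner_diff_left inner_sum_left)
  also have "(\<Sum>k<n. (v n \<bullet> ?u k / (?u k \<bullet> ?u k)) * (?u k \<bullet> ?u j))
      = (\<Sum>k\<in>{j}. (v n \<bullet> ?u k / (?u k \<bullet> ?u k)) * (?u k \<bullet> ?u j))"
    using less.prems * by (intro sum.mono_neutral_right) auto
  \<comment> \<open>The quotient fails to cancel only if \<open>?u j = 0\<close>, and then both
    sides are 0.\<close>
  also have "\<dots> = v n \<bullet> ?u j"
    by (cases "?u j = 0") auto
  finally show ?case by simp
qed

lemma gram_schmidt_orthogonal:
  "i \<noteq> j \<Longrightarrow> gram_schmidt v i \<bullet> gram_schmidt v j = 0"
  by (metis gram_schmidt_orthogonal_less inner_commute linorder_neqE_nat)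

text \<open>The cut-off \<open>N\<close> is free above \<open>n\<close>, so that finitely many
  vectors can be expanded over one common index range. Triangularity lets each \<open>v n\<close> be
  represented later by a finite Rademacher sum.\<close>

lemma ex_orthogonal_triangular:
  fixes v :: "nat \<Rightarrow> 'a::real_inner"
  obtains u c where "\<And>i j. i \<noteq> j \<Longrightarrow> u i \<bullet> u j = 0"
    and "\<And>n N. n < N \<Longrightarrow> v n = (\<Sum>k<N. c n k *\<^sub>R u k)"
    and "\<And>n k. n < k \<Longrightarrow> c n k = 0"
proof -
  let ?u = "gram_schmidt v"
  define c where "c = (\<lambda>n k. if k < n then v n \<bullet> ?u k / (?u k \<bullet> ?u k) else if k = n then 1 else 0)"
  have 1: "v n = (\<Sum>k<N. c n k *\<^sub>R ?u k)" if "n < N" for n N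
  proof -
    have "(\<Sum>k<N. c n k *\<^sub>R ?u k) = (\<Sum>k<Suc n. c n k *\<^sub>R ?u k)"
      using that by (intro sum.mono_neutral_right) (auto simp: c_def)
    also have "\<dots> = (\<Sum>k<n. c n k *\<^sub>R ?u k) + ?u n"
      by (simp add: c_def)
    also have "(\<Sum>k<n. c n k *\<^sub>R ?u k) = (\<Sum>k<n. (v n \<bullet> ?u k / (?u k \<bullet> ?u k)) *\<^sub>R ?u k)"
      by (intro sum.cong) (auto simp: c_def)
    also have "\<dots> + ?u n = v n"
      by (subst (4) gram_schmidt.simps) simp
    finally show ?thesis by simp
  qed
  show thesis
    by (rule that[of ?u c]) (use 1 in \<open>auto simp: gram_schmidt_orthogonal c_def\<close>)
qed

lemma norm_sum_orthogonal:
  fixes u :: "'i \<Rightarrow> 'a::real_inner"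
  assumes "\<And>i j. i \<noteq> j \<Longrightarrow> u i \<bullet> u j = 0" "finite F"
  shows "(norm (\<Sum>k\<in>F. g k *\<^sub>R u k))\<^sup>2 = (\<Sum>k\<in>F. (g k * norm (u k))\<^sup>2)"
  using assms(2)
proof (subst norm_sum_Pythagorean, goal_cases)
  case 2
  then show ?case
    by (auto simp: pairwise_def orthogonal_def assms(1))
qed (simp_all add: power_mult_distrib)

section \<open>Khintchine's inequality\<close>

text \<open>The sign belonging to the binary digit of \<open>x\<close> in position
  \<open>k + 1\<close> after the point: 1 for digit 0, -1 for digit 1. The fractional part makes it
  1-periodic on the whole line, so doubling the argument just shifts the index.\<close>

definition rademacher :: "nat \<Rightarrow> real \<Rightarrow> real" where
  "rademacher k x = (if frac (2 ^ k * x) < 1 / 2 then 1 else -1)"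

lemma rademacher_Suc: "rademacher (Suc k) x = rademacher k (2 * x)"
  by (simp add: rademacher_def mult.assoc mult.commute mult.left_commute)

lemma rademacher_periodic: "rademacher k (x + 1) = rademacher k x"
proof -
  have "frac (2 ^ k * (x + 1)) = frac (2 ^ k * x + of_int (2 ^ k))"
    by (simp add: algebra_simps)
  also have "\<dots> = frac (2 ^ k * x)"
    by (simp only: frac_def floor_add_int of_int_add) simp
  finally show ?thesis by (simp add: rademacher_def)
qed

lemma rademacher_0:
  "0 \<le> x \<Longrightarrow> x < 1 / 2 \<Longrightarrow> rademacher 0 x = 1"
  "1 / 2 \<le> x \<Longrightarrow> x < 1 \<Longrightarrow> rademacher 0 x = -1"
proof -
  show "0 \<le> x \<Longrightarrow> x < 1 / 2 \<Longrightarrow> rademacher 0 x = 1"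
    by (simp add: rademacher_def frac_eq)
  assume "1 / 2 \<le> x" "x < 1"
  then have "frac x = x" by (simp add: frac_eq)
  then show "rademacher 0 x = -1" using \<open>1 / 2 \<le> x\<close> by (simp add: rademacher_def)
qed

lemma borel_measurable_rademacher [measurable]: "rademacher k \<in> borel_measurable borel"
  unfolding rademacher_def frac_def by measurable

lemma abs_rademacher [simp]: "\<bar>rademacher k x\<bar> = 1"
  by (simp add: rademacher_def)

definition rsum :: "nat \<Rightarrow> (nat \<Rightarrow> real) \<Rightarrow> real \<Rightarrow> real" where
  "rsum n a x = (\<Sum>k<n. a k * rademacher k x)"

lemma borel_measurable_rsum [measurable]: "rsum n a \<in> borel_measurable borel"
  unfolding rsum_def by measurable

lemma abs_rsum_le: "\<bar>rsum n a x\<bar> \<le> (\<Sum>k<n. \<bar>a k\<bar>)"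
  unfolding rsum_def by (rule order_trans[OF sum_abs]) (simp add: abs_mult)

lemma rsum_Suc: "rsum (Suc n) a x = a 0 * rademacher 0 x + rsum n (\<lambda>k. a (Suc k)) (2 * x)"
  by (simp add: rsum_def sum.lessThan_Suc_shift rademacher_Suc del: sum.lessThan_Suc)

lemma rsum_periodic: "rsum n a (x + 1) = rsum n a x"
  by (simp add: rsum_def rademacher_periodic)

lemma integrable_bounded_on_unit:
  fixes f :: "real \<Rightarrow> real"
  assumes [measurable]: "f \<in> borel_measurable borel" and "\<And>x. \<bar>f x\<bar> \<le> B"
  shows "integrable lborel (\<lambda>x. indicator {0..<1} x * f x)"
proof (rule Bochner_Integration.integrable_bound)
  show "integrable lborel (\<lambda>x::real. B * indicator {0..<1} x)" by simp
  show "AE x in lborel. norm (indicator {0..<1} x * f x) \<le> norm (B * indicator {0..<1::real} x)"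
    using assms(2) by (auto intro!: AE_I2 simp: indicator_def abs_le_iff intro: order_trans abs_ge_self)
qed simp

text \<open>A Rademacher sum is bounded, so \<open>c + rsum n a x\<close> stays in a compact
  interval, on which the continuous \<open>\<phi>\<close> is bounded.\<close>

lemma integrable_rsum:
  assumes "continuous_on UNIV \<phi>"
  shows "integrable lborel (\<lambda>x. indicator {0..<1} x * (\<phi> (c + rsum n a x) :: real))"
proof -
  define B where "B = \<bar>c\<bar> + (\<Sum>k<n. \<bar>a k\<bar>)"
  have "bounded (\<phi> ` {-B..B})"
    by (intro compact_imp_bounded compact_continuous_image continuous_on_subset[OF assms]) auto
  then obtain K where K: "\<And>y. y \<in> {-B..B} \<Longrightarrow> \<bar>\<phi> y\<bar> \<le> K"
    unfolding bounded_iff by force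
  have [measurable]: "\<phi> \<in> borel_measurable borel"
    using assms by (rule borel_measurable_continuous_onI)
  show ?thesis
  proof (rule integrable_bounded_on_unit[of _ K])
    show "\<bar>\<phi> (c + rsum n a x)\<bar> \<le> K" for x
      using abs_rsum_le[of n a x] by (intro K) (auto simp: B_def abs_le_iff)
  qed measurable
qed

text \<open>
  Conditioning on the first digit: on each half of the unit interval the first Rademacher
  function is constant and the others are a rescaled copy of the whole sequence.
\<close>

lemma integral_rsum_Suc:
  assumes "continuous_on UNIV \<phi>"
  defines "T \<equiv> \<lambda>a n. rsum n (\<lambda>k. a (Suc k))"
  shows "(\<integral>x. indicator {0..<1} x * (\<phi> (rsum (Suc n) a x) :: real) \<partial>lborel) =
    (\<integral>x. indicator {0..<1} x * ((\<phi> (a 0 + T a n x) + \<phi> (- a 0 + T a n x)) / 2) \<partial>lborel)"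
proof -
  let ?h = "\<lambda>x. \<phi> (rsum (Suc n) a x)"
  have i: "integrable lborel (\<lambda>x. indicator {0..<1} x * ?h x)"
    using integrable_rsum[OF assms(1), of 0] by simp
  have [measurable]: "\<phi> \<in> borel_measurable borel"
    using assms by (intro borel_measurable_continuous_onI)
  have i1: "integrable lborel (\<lambda>x. indicator {0..<1/2} x * ?h x)"
    by (rule Bochner_Integration.integrable_bound[OF i]) (auto simp: indicator_def)
  have i2: "integrable lborel (\<lambda>x. indicator {1/2..<1} x * ?h x)"
    by (rule Bochner_Integration.integrable_bound[OF i]) (auto simp: indicator_def)
  have "(\<integral>x. indicator {0..<1} x * ?h x \<partial>lborel) =
      (\<integral>x. indicator {0..<1/2} x * ?h x + indicator {1/2..<1} x * ?h x \<partial>lborel)"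
    by (intro Bochner_Integration.integral_cong) (auto simp: indicator_def)
  also have "\<dots> = (\<integral>x. indicator {0..<1/2} x * ?h x \<partial>lborel) +
      (\<integral>x. indicator {1/2..<1} x * ?h x \<partial>lborel)"
    using i1 i2 by simp
  also have "(\<integral>x. indicator {0..<1/2} x * ?h x \<partial>lborel) =
      (\<integral>x. indicator {0..<1} x * \<phi> (a 0 + T a n x) \<partial>lborel) / 2"
  proof -
    have "(indicator {0..<1/2} (0 + 1 / 2 * x) :: real) * ?h (0 + 1 / 2 * x)
        = indicator {0..<1} x * \<phi> (a 0 + T a n x)" for x :: real
      by (auto simp: indicator_def rsum_Suc rademacher_0 T_def)
    then show ?thesis
      by (subst lborel_integral_real_affine[of "1/2" _ 0]) auto
  qed
  also have "(\<integral>x. indicator {1/2..<1} x * ?h x \<partial>lborel) =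
      (\<integral>x. indicator {0..<1} x * \<phi> (- a 0 + T a n x) \<partial>lborel) / 2"
  proof -
    have "(indicator {1/2..<1} (1 / 2 + 1 / 2 * x) :: real) * ?h (1 / 2 + 1 / 2 * x)
        = indicator {0..<1} x * \<phi> (- a 0 + T a n x)" for x :: real
    proof -
      \<comment> \<open>Doubling the substituted point gives \<open>1 + x\<close>, and periodicity
        removes the 1.\<close>
      have "rsum m c (2 * (1 / 2 + 1 / 2 * x)) = rsum m c x" for m c
        using rsum_periodic[of m c x] by (simp add: add.commute)
      then show ?thesis
        unfolding rsum_Suc T_def by (auto simp: indicator_def rademacher_0)
    qed
    then show ?thesis
      by (subst lborel_integral_real_affine[of "1/2" _ "1/2"]) auto
  qed
  also have "(\<integral>x. indicator {0..<1} x * \<phi> (a 0 + T a n x) \<partial>lborel) / 2 +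
      (\<integral>x. indicator {0..<1} x * \<phi> (- a 0 + T a n x) \<partial>lborel) / 2 =
    (\<integral>x. indicator {0..<1} x * \<phi> (a 0 + T a n x) / 2 +
       indicator {0..<1} x * \<phi> (- a 0 + T a n x) / 2 \<partial>lborel)"
    using integrable_rsum[OF assms(1), of "a 0" n "\<lambda>k. a (Suc k)"]
      integrable_rsum[OF assms(1), of "- a 0" n "\<lambda>k. a (Suc k)"]
    unfolding T_def by (subst Bochner_Integration.integral_add) simp_all
  also have "\<dots> = (\<integral>x. indicator {0..<1} x * ((\<phi> (a 0 + T a n x) + \<phi> (- a 0 + T a n x)) / 2) \<partial>lborel)"
    by (intro Bochner_Integration.integral_cong) (auto simp: field_simps)
  finally show ?thesis .
qed

section \<open>Moments of Rademacher sums\<close>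

lemma integrable_rsum_power:
  "integrable lborel (\<lambda>x. indicator {0..<1} x * (rsum n a x ^ p))"
  using integrable_rsum[of "\<lambda>y. y ^ p" 0 n a] by (simp add: continuous_on_power)

text \<open>Induction on the number of terms: averaging over the sign of \<open>a 0\<close> kills
  the cross term.\<close>

lemma rsum_moment2:
  "(\<integral>x. indicator {0..<1} x * (rsum n a x)\<^sup>2 \<partial>lborel) = (\<Sum>k<n. (a k)\<^sup>2)"
proof (induction n arbitrary: a)
  case 0
  then show ?case by (simp add: rsum_def)
next
  case (Suc n)
  let ?T = "rsum n (\<lambda>k. a (Suc k))"
  have "(\<integral>x. indicator {0..<1} x * (rsum (Suc n) a x)\<^sup>2 \<partial>lborel) =
      (\<integral>x. indicator {0..<1} x * (((a 0 + ?T x)\<^sup>2 + (- a 0 + ?T x)\<^sup>2) / 2) \<partial>lborel)"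
    by (rule integral_rsum_Suc) (intro continuous_intros)
  also have "\<dots> = (\<integral>x. indicator {0..<1} x * (a 0)\<^sup>2 + indicator {0..<1} x * (?T x)\<^sup>2 \<partial>lborel)"
    by (intro Bochner_Integration.integral_cong) (auto simp: power2_eq_square algebra_simps add_divide_distrib)
  also have "\<dots> = (a 0)\<^sup>2 + (\<Sum>k<n. (a (Suc k))\<^sup>2)"
    using integrable_rsum_power[of n _ 2]
    by (subst Bochner_Integration.integral_add) (auto simp: Suc.IH)
  also have "\<dots> = (\<Sum>k<Suc n. (a k)\<^sup>2)"
    by (simp add: sum.lessThan_Suc_shift del: sum.lessThan_Suc)
  finally show ?case .
qed

text \<open>Averaging over the sign of \<open>a 0\<close> removes the odd powers and leaves
  \<open>a 0 ^ 4 + 6 * (a 0)\<^sup>2 * ?A\<close> plus the fourth moment of the rest. The constant 3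
  turns the mixed term of the squared sum into exactly \<open>6 * (a 0)\<^sup>2 * ?A\<close>; the
  slack is \<open>2 * a 0 ^ 4\<close>.\<close>

lemma rsum_moment4:
  "(\<integral>x. indicator {0..<1} x * rsum n a x ^ 4 \<partial>lborel) \<le> 3 * (\<Sum>k<n. (a k)\<^sup>2)\<^sup>2"
proof (induction n arbitrary: a)
  case 0
  then show ?case by (simp add: rsum_def)
next
  case (Suc n)
  let ?T = "rsum n (\<lambda>k. a (Suc k))" and ?A = "\<Sum>k<n. (a (Suc k))\<^sup>2"
  have "(\<integral>x. indicator {0..<1} x * rsum (Suc n) a x ^ 4 \<partial>lborel) =
      (\<integral>x. indicator {0..<1} x * (((a 0 + ?T x) ^ 4 + (- a 0 + ?T x) ^ 4) / 2) \<partial>lborel)"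
    by (rule integral_rsum_Suc) (intro continuous_intros)
  also have "\<dots> = (\<integral>x. indicator {0..<1} x * (a 0) ^ 4 +
      (6 * (a 0)\<^sup>2 * (indicator {0..<1} x * (?T x)\<^sup>2) + indicator {0..<1} x * ?T x ^ 4) \<partial>lborel)"
    by (intro Bochner_Integration.integral_cong)
      (auto simp: power2_eq_square power4_eq_xxxx algebra_simps indicator_def)
  also have "\<dots> = (a 0) ^ 4 + (6 * (a 0)\<^sup>2 * ?A + (\<integral>x. indicator {0..<1} x * ?T x ^ 4 \<partial>lborel))"
    using integrable_rsum_power[of n _ 2] integrable_rsum_power[of n _ 4]
    by (subst Bochner_Integration.integral_add, simp, simp)
      (subst Bochner_Integration.integral_add, auto simp: rsum_moment2)
  also have "\<dots> \<le> (a 0) ^ 4 + (6 * (a 0)\<^sup>2 * ?A + 3 * ?A\<^sup>2)"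
    using Suc.IH by simp
  also have "\<dots> \<le> 3 * ((a 0)\<^sup>2 + ?A)\<^sup>2"
    using zero_le_power2[of "(a 0)\<^sup>2"] by (simp add: power2_eq_square power4_eq_xxxx algebra_simps)
  also have "(a 0)\<^sup>2 + ?A = (\<Sum>k<Suc n. (a k)\<^sup>2)"
    by (simp add: sum.lessThan_Suc_shift del: sum.lessThan_Suc)
  finally show ?case .
qed

text \<open>Both bounds integrate a pointwise inequality for
  \<open>y = \<bar>rsum n a x\<bar>\<close>. The upper one is
  \<open>2 * s * y \<le> y\<^sup>2 + s\<^sup>2\<close> with the second moment. The lower one is
  \<open>4 * s\<^sup>2 * y\<^sup>2 - y ^ 4 \<le> 4 * s ^ 3 * y\<close>, whose left side has integral
  at least \<open>4 * s ^ 4 - 3 * s ^ 4\<close> by the second and fourth moments.\<close>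

lemma khintchine:
  defines "I \<equiv> \<lambda>n a. \<integral>x. indicator {0..<1} x * \<bar>rsum n a x\<bar> \<partial>lborel"
  shows khintchine_upper: "I n a \<le> sqrt (\<Sum>k<n. (a k)\<^sup>2)"
    and khintchine_lower: "sqrt (\<Sum>k<n. (a k)\<^sup>2) \<le> 4 * I n a"
proof -
  define A where "A = (\<Sum>k<n. (a k)\<^sup>2)"
  define s where "s = sqrt A"
  have A0: "A \<ge> 0" by (simp add: A_def sum_nonneg)
  have I0: "I n a \<ge> 0" by (auto simp: I_def intro!: integral_nonneg_AE)
  have As: "A = s\<^sup>2" using A0 by (simp add: s_def)
  have iI: "integrable lborel (\<lambda>x. indicator {0..<1} x * \<bar>rsum n a x\<bar>)"
    using integrable_rsum[of abs 0 n a] by (simp add: continuous_on_rabs)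
  have "I n a \<le> s \<and> s \<le> 4 * I n a"
  \<comment> \<open>The degenerate case is split off because powers of \<open>s\<close> are
    cancelled in the other one.\<close>
  proof (cases "s = 0")
    case True
    then have "A = 0" by (simp add: As)
    then have "a k = 0" if "k < n" for k
      using that by (simp add: A_def sum_nonneg_eq_0_iff)
    then have "rsum n a x = 0" for x by (simp add: rsum_def)
    then have "I n a = 0" by (simp add: I_def)
    then show ?thesis using True by simp
  next
    case False
    then have s: "s > 0" using A0 by (simp add: s_def)
    have "2 * s * I n a = (\<integral>x. 2 * s * (indicator {0..<1} x * \<bar>rsum n a x\<bar>) \<partial>lborel)"
      by (simp add: I_def)
    also have "\<dots> \<le> (\<integral>x. indicator {0..<1} x * (rsum n a x)\<^sup>2 + indicator {0..<1} x * s\<^sup>2 \<partial>lborel)"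
    proof (rule integral_mono)
      fix x :: real
      show "2 * s * (indicator {0..<1} x * \<bar>rsum n a x\<bar>) \<le>
          indicator {0..<1} x * (rsum n a x)\<^sup>2 + indicator {0..<1} x * s\<^sup>2"
        using sum_squares_bound[of s "\<bar>rsum n a x\<bar>"] by (auto simp: indicator_def)
    qed (use iI integrable_rsum_power[of n a 2] in auto)
    also have "\<dots> = s\<^sup>2 + s\<^sup>2"
      using integrable_rsum_power[of n a 2]
      by (subst Bochner_Integration.integral_add) (auto simp: rsum_moment2 As[symmetric] A_def)
    finally have "2 * s * I n a \<le> 2 * s * s" by (simp add: power2_eq_square)
    then have 1: "I n a \<le> s" using s by simp
    have "4 * s ^ 4 - 3 * s ^ 4 \<le> 4 * s\<^sup>2 * A - (\<integral>x. indicator {0..<1} x * rsum n a x ^ 4 \<partial>lborel)"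
      using rsum_moment4[of n a] unfolding A_def[symmetric] As
      by (simp add: power2_eq_square power4_eq_xxxx)
    also have "\<dots> = (\<integral>x. 4 * s\<^sup>2 * (indicator {0..<1} x * (rsum n a x)\<^sup>2) -
        indicator {0..<1} x * rsum n a x ^ 4 \<partial>lborel)"
      using integrable_rsum_power[of n a 2] integrable_rsum_power[of n a 4]
      by (subst Bochner_Integration.integral_diff) (auto simp: rsum_moment2 A_def)
    also have "\<dots> \<le> (\<integral>x. 4 * s ^ 3 * (indicator {0..<1} x * \<bar>rsum n a x\<bar>) \<partial>lborel)"
    proof (rule integral_mono)
      fix x :: real
      define y where "y = \<bar>rsum n a x\<bar>"
      have y: "y \<ge> 0" "(rsum n a x)\<^sup>2 = y\<^sup>2" "rsum n a x ^ 4 = y ^ 4"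
        by (simp_all add: y_def power_even_abs)
      \<comment> \<open>The desired inequality divided by \<open>y\<close>. For
        \<open>y \<le> 2 * s\<close>, the part \<open>y ^ 3 - 3 * y * s\<^sup>2 + 2 * s ^ 3\<close>
        has a double root at \<open>s\<close> and factors; for larger \<open>y\<close>, the cube
        dominates \<open>4 * y * s\<^sup>2\<close>.\<close>
      have "0 \<le> y ^ 3 + 4 * s ^ 3 - 4 * y * s\<^sup>2"
      proof (cases "y \<le> 2 * s")
        case True
        have "y ^ 3 + 4 * s ^ 3 - 4 * y * s\<^sup>2 = (y - s)\<^sup>2 * (y + 2 * s) + s\<^sup>2 * (2 * s - y)"
          by (simp add: power2_eq_square power3_eq_cube algebra_simps)
        also have "\<dots> \<ge> 0" using True y s by simp
        finally show ?thesis .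
      next
        case False
        have "y ^ 3 + 4 * s ^ 3 - 4 * y * s\<^sup>2 = y * (y - 2 * s) * (y + 2 * s) + 4 * s ^ 3"
          by (simp add: power2_eq_square power3_eq_cube algebra_simps)
        also have "\<dots> \<ge> 0" using False y s by simp
        finally show ?thesis .
      qed
      then have "0 \<le> y * (y ^ 3 + 4 * s ^ 3 - 4 * y * s\<^sup>2)"
        using y by simp
      then have "4 * s\<^sup>2 * y\<^sup>2 - y ^ 4 \<le> 4 * s ^ 3 * y"
        by (simp add: power2_eq_square power3_eq_cube power4_eq_xxxx algebra_simps)
      then show "4 * s\<^sup>2 * (indicator {0..<1} x * (rsum n a x)\<^sup>2) - indicator {0..<1} x * rsum n a x ^ 4
          \<le> 4 * s ^ 3 * (indicator {0..<1} x * \<bar>rsum n a x\<bar>)"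
        by (auto simp: indicator_def y y_def[symmetric])
    qed (use iI integrable_rsum_power[of n a 2] integrable_rsum_power[of n a 4] in auto)
    also have "\<dots> = 4 * s ^ 3 * I n a" by (simp add: I_def)
    finally have "s ^ 3 * s \<le> s ^ 3 * (4 * I n a)"
      by (simp add: power3_eq_cube power4_eq_xxxx)
    then have "s \<le> 4 * I n a" using s by simp
    with 1 show ?thesis by simp
  qed
  then show "I n a \<le> sqrt (\<Sum>k<n. (a k)\<^sup>2)" "sqrt (\<Sum>k<n. (a k)\<^sup>2) \<le> 4 * I n a"
    by (simp_all add: s_def A_def)
qed


section \<open>Representation of a sequence of vectors by integrable functions\<close>

lemma sum_scaleR_sum_scaleR:
  fixes c :: "nat \<Rightarrow> nat \<Rightarrow> real" and g :: "nat \<Rightarrow> 'a::real_vector"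
  shows "(\<Sum>n\<in>F. f n *\<^sub>R (\<Sum>k<N. c n k *\<^sub>R g k)) = (\<Sum>k<N. (\<Sum>n\<in>F. f n * c n k) *\<^sub>R g k)"
proof -
  have "(\<Sum>n\<in>F. f n *\<^sub>R (\<Sum>k<N. c n k *\<^sub>R g k)) = (\<Sum>n\<in>F. \<Sum>k<N. (f n * c n k) *\<^sub>R g k)"
    by (simp add: scaleR_sum_right)
  also have "\<dots> = (\<Sum>k<N. \<Sum>n\<in>F. (f n * c n k) *\<^sub>R g k)"
    by (rule sum.swap)
  finally show ?thesis by (simp add: scaleR_sum_left)
qed

text \<open>Integrating over the unit interval gives the Khintchine average of the coefficients in
  an orthogonal system; the rest of the line gives \<open>\<Sum>n\<in>F. \<bar>f n\<bar>\<close>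
  exactly. Hence only the Hilbert space part loses a factor 4.\<close>

proposition ex_L1_representation:
  fixes v :: "nat \<Rightarrow> 'a::real_inner"
  obtains \<Phi> :: "nat \<Rightarrow> real \<Rightarrow> real" where
    "\<And>n. integrable lborel (\<Phi> n)"
    "\<And>F f. finite F \<Longrightarrow> (\<integral>x. \<bar>\<Sum>n\<in>F. f n * \<Phi> n x\<bar> \<partial>lborel)
        \<le> norm (\<Sum>n\<in>F. f n *\<^sub>R v n) + (\<Sum>n\<in>F. \<bar>f n\<bar>)"
    "\<And>F f. finite F \<Longrightarrow> norm (\<Sum>n\<in>F. f n *\<^sub>R v n) / 4 + (\<Sum>n\<in>F. \<bar>f n\<bar>)
        \<le> (\<integral>x. \<bar>\<Sum>n\<in>F. f n * \<Phi> n x\<bar> \<partial>lborel)"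
proof -
  obtain u c where orth: "\<And>i j. i \<noteq> j \<Longrightarrow> u i \<bullet> u j = 0"
    and v: "\<And>n N. n < N \<Longrightarrow> v n = (\<Sum>k<N. c n k *\<^sub>R u k)"
    and c: "\<And>n k. n < k \<Longrightarrow> c n k = 0"
    by (rule ex_orthogonal_triangular[of v]) blast
  \<comment> \<open>By triangularity the coefficients beyond index \<open>n\<close> vanish, so
    \<open>Suc n\<close> terms suffice.\<close>
  define X where "X n = rsum (Suc n) (\<lambda>k. c n k * norm (u k))" for n
  \<comment> \<open>The intervals begin at 1, which keeps them disjoint from the unit interval as
    well as from each other.\<close>
  define J where "J n = {real (Suc n)..<real (Suc n) + 1}" for n
  define \<Phi> where "\<Phi> n x = indicator {0..<1} x * X n x + indicator (J n) x" for n x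
  have iX: "integrable lborel (\<lambda>x. indicator {0..<1} x * X n x)" for n
    using integrable_rsum_power[of "Suc n" _ 1] by (simp add: X_def)
  have 1: "integrable lborel (\<Phi> n)" for n
    unfolding \<Phi>_def J_def using iX by (intro Bochner_Integration.integrable_add) auto
  \<comment> \<open>Both estimates come from one identity: a single sequence \<open>a\<close> has
    the Hilbert norm as its Euclidean norm and also gives the Rademacher sum on the unit
    interval.\<close>
  have norm_eq: "\<exists>N a. norm (\<Sum>n\<in>F. f n *\<^sub>R v n) = sqrt (\<Sum>k<N. (a k)\<^sup>2) \<and>
      (\<integral>x. \<bar>\<Sum>n\<in>F. f n * \<Phi> n x\<bar> \<partial>lborel) =
        (\<integral>x. indicator {0..<1} x * \<bar>rsum N a x\<bar> \<partial>lborel) + (\<Sum>n\<in>F. \<bar>f n\<bar>)"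
    if F: "finite F" for F f
  proof -
    obtain N where N: "\<And>n. n \<in> F \<Longrightarrow> n < N"
      using F finite_nat_set_iff_bounded by auto
    define g where "g k = (\<Sum>n\<in>F. f n * c n k)" for k
    define a where "a k = g k * norm (u k)" for k
    have "(\<Sum>n\<in>F. f n *\<^sub>R v n) = (\<Sum>n\<in>F. f n *\<^sub>R (\<Sum>k<N. c n k *\<^sub>R u k))"
      using N v by (intro sum.cong) auto
    also have "\<dots> = (\<Sum>k<N. g k *\<^sub>R u k)"
      unfolding g_def by (rule sum_scaleR_sum_scaleR)
    finally have "(norm (\<Sum>n\<in>F. f n *\<^sub>R v n))\<^sup>2 = (\<Sum>k<N. (a k)\<^sup>2)"
      using norm_sum_orthogonal[of u "{..<N}" g, OF orth] by (simp add: a_def)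
    then have "norm (\<Sum>n\<in>F. f n *\<^sub>R v n) = sqrt (\<Sum>k<N. (a k)\<^sup>2)"
      by (metis norm_ge_zero real_sqrt_unique)
    moreover
    have XN: "X n x = rsum N (\<lambda>k. c n k * norm (u k)) x" if "n < N" for n x
      unfolding X_def rsum_def using that c by (intro sum.mono_neutral_left) auto
    have sumX: "(\<Sum>n\<in>F. f n * X n x) = rsum N a x" for x
    proof -
      have "(\<Sum>n\<in>F. f n * X n x) = (\<Sum>n\<in>F. f n *\<^sub>R (\<Sum>k<N. c n k *\<^sub>R (norm (u k) * rademacher k x)))"
        using N XN by (intro sum.cong) (auto simp: rsum_def mult.assoc)
      \<comment> \<open>The same exchange of sums as for the vectors \<open>u k\<close>, now with
        real numbers, so the same coefficients \<open>g\<close> appear.\<close>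
      also have "\<dots> = (\<Sum>k<N. g k *\<^sub>R (norm (u k) * rademacher k x))"
        unfolding g_def by (rule sum_scaleR_sum_scaleR)
      finally show ?thesis by (simp add: a_def rsum_def mult.assoc)
    qed
    have "\<bar>\<Sum>n\<in>F. f n * \<Phi> n x\<bar> =
        indicator {0..<1} x * \<bar>rsum N a x\<bar> + (\<Sum>n\<in>F. \<bar>f n\<bar> * indicator (J n) x)" for x
    proof (cases "x \<in> {0..<1}")
      case True
      then have "indicator (J n) x = (0::real)" for n by (auto simp: J_def indicator_def)
      then show ?thesis using True by (simp add: \<Phi>_def sumX)
    next
      case False
      then have \<Phi>: "\<Phi> n x = indicator (J n) x" for n by (auto simp: \<Phi>_def)
      \<comment> \<open>The floor selects the only possible interval. For \<open>x < 0\<close>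
        truncation gives 0, which is never \<open>Suc n\<close>.\<close>
      have *: "indicator (J n) x = (if nat \<lfloor>x\<rfloor> = Suc n then 1 else (0::real))" for n
      proof -
        have "real (Suc n) \<le> x \<and> x < real (Suc n) + 1 \<longleftrightarrow> nat \<lfloor>x\<rfloor> = Suc n"
          by linarith
        then show ?thesis by (auto simp: J_def indicator_def)
      qed
      show ?thesis
      proof (cases "\<exists>m\<in>F. nat \<lfloor>x\<rfloor> = Suc m")
        case True
        then obtain m where m: "m \<in> F" "nat \<lfloor>x\<rfloor> = Suc m" by auto
        have "(\<Sum>n\<in>F. h n * indicator (J n) x) = h m" for h :: "nat \<Rightarrow> real"
        proof -
          have "(\<Sum>n\<in>F. h n * indicator (J n) x) = (\<Sum>n\<in>F. if m = n then h n else 0)"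
            using m(2) by (intro sum.cong) (auto simp: *)
          then show ?thesis using F m(1) by simp
        qed
        then show ?thesis using False by (simp add: \<Phi>)
      next
        case no: False
        then have "(\<Sum>n\<in>F. h n * indicator (J n) x) = 0" for h :: "nat \<Rightarrow> real"
          by (intro sum.neutral) (auto simp: *)
        then show ?thesis using False by (simp add: \<Phi>)
      qed
    qed
    moreover have "(\<integral>x. indicator {0..<1} x * \<bar>rsum N a x\<bar> + (\<Sum>n\<in>F. \<bar>f n\<bar> * indicator (J n) x) \<partial>lborel) =
        (\<integral>x. indicator {0..<1} x * \<bar>rsum N a x\<bar> \<partial>lborel) + (\<Sum>n\<in>F. \<bar>f n\<bar>)"
      using integrable_rsum[of abs 0 N a]
      by (subst Bochner_Integration.integral_add) (auto simp: J_def continuous_on_rabs)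
    ultimately show ?thesis by auto
  qed
  show thesis
  proof (rule that[of \<Phi>])
    fix F :: "nat set" and f :: "nat \<Rightarrow> real"
    assume "finite F"
    from norm_eq[OF this, of f] obtain N a where
      *: "norm (\<Sum>n\<in>F. f n *\<^sub>R v n) = sqrt (\<Sum>k<N. (a k)\<^sup>2)"
      "(\<integral>x. \<bar>\<Sum>n\<in>F. f n * \<Phi> n x\<bar> \<partial>lborel) =
        (\<integral>x. indicator {0..<1} x * \<bar>rsum N a x\<bar> \<partial>lborel) + (\<Sum>n\<in>F. \<bar>f n\<bar>)"
      by auto
    show "(\<integral>x. \<bar>\<Sum>n\<in>F. f n * \<Phi> n x\<bar> \<partial>lborel) \<le> norm (\<Sum>n\<in>F. f n *\<^sub>R v n) + (\<Sum>n\<in>F. \<bar>f n\<bar>)"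
      using khintchine_upper[where n = N and a = a] * by simp
    show "norm (\<Sum>n\<in>F. f n *\<^sub>R v n) / 4 + (\<Sum>n\<in>F. \<bar>f n\<bar>) \<le> (\<integral>x. \<bar>\<Sum>n\<in>F. f n * \<Phi> n x\<bar> \<partial>lborel)"
      using khintchine_lower[where n = N and a = a] * by simp
  qed (rule 1)
qed

section \<open>Completeness of \<open>L\<^sup>1(\<real>)\<close>\<close>

lemma Cauchy_fast_subsequence:
  fixes X :: "nat \<Rightarrow> 'a::metric_space"
  assumes "Cauchy X"
  obtains r :: "nat \<Rightarrow> nat" where "strict_mono r" "\<And>n. dist (X (r (Suc n))) (X (r n)) < (1 / 2) ^ n"
proof -
  \<comment> \<open>The bound is required of all pairs of indices from \<open>r n\<close> on, so the
    next index may be chosen arbitrarily late.\<close>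
  have "\<exists>r. \<forall>n. (\<forall>i\<ge>r n. \<forall>j\<ge>r n. dist (X i) (X j) < (1 / 2) ^ n) \<and> r n < r (Suc n)"
  proof (rule dependent_nat_choice)
    show "\<exists>x. \<forall>i\<ge>x. \<forall>j\<ge>x. dist (X i) (X j) < (1 / 2) ^ 0"
      using metric_CauchyD[OF assms, of 1] by auto
  next
    fix x n :: nat
    obtain M where M: "\<forall>i\<ge>M. \<forall>j\<ge>M. dist (X i) (X j) < (1 / 2) ^ Suc n"
      using metric_CauchyD[OF assms, of "(1 / 2) ^ Suc n"] by auto
    then show "\<exists>y. (\<forall>i\<ge>y. \<forall>j\<ge>y. dist (X i) (X j) < (1 / 2) ^ Suc n) \<and> x < y"
      by (intro exI[of _ "max M (Suc x)"]) auto
  qed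
  then obtain r where r: "\<And>n i j. r n \<le> i \<Longrightarrow> r n \<le> j \<Longrightarrow> dist (X i) (X j) < (1 / 2) ^ n"
    and mono: "\<And>n. r n < r (Suc n)" by metis
  show thesis
  proof (rule that)
    show "strict_mono r" using mono by (simp add: strict_mono_Suc_iff)
    show "dist (X (r (Suc n))) (X (r n)) < (1 / 2) ^ n" for n
      by (rule r) (use mono[of n] in auto)
  qed
qed

text \<open>The increments along a fast subsequence are absolutely summable and telescope, so the
  subsequence converges, and with it the Cauchy sequence. This reduces completeness to series, for
  which the convergence theorems of integration are available.\<close>

lemma Cauchy_convergent_if_abs_summable:
  fixes X :: "nat \<Rightarrow> 'a::real_normed_vector"
  assumes "\<And>h :: nat \<Rightarrow> 'a. summable (\<lambda>n. norm (h n)) \<Longrightarrow> summable h" and "Cauchy X"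
  shows "convergent X"
proof -
  obtain r where r: "strict_mono r" "\<And>n. dist (X (r (Suc n))) (X (r n)) < (1 / 2) ^ n"
    using Cauchy_fast_subsequence[OF assms(2)] by blast
  define h where "h n = X (r (Suc n)) - X (r n)" for n
  have "summable (\<lambda>n. norm (h n))"
  proof (rule summable_comparison_test')
    show "summable (\<lambda>n. (1 / 2 :: real) ^ n)" by (rule summable_geometric) simp
    show "norm (norm (h n)) \<le> (1 / 2) ^ n" for n
      using r(2)[of n] by (simp add: h_def dist_norm)
  qed
  then have "(\<lambda>n. X (r 0) + (\<Sum>i<n. h i)) \<longlonglongrightarrow> X (r 0) + suminf h"
    by (intro tendsto_add tendsto_const summable_LIMSEQ assms(1))
  moreover have "X (r 0) + (\<Sum>i<n. h i) = X (r n)" for n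
    using sum_lessThan_telescope[of "\<lambda>i. X (r i)" n] by (simp add: h_def)
  ultimately have "(X \<circ> r) \<longlonglongrightarrow> X (r 0) + suminf h"
    by (simp add: comp_def)
  then show ?thesis
    unfolding convergent_def using Cauchy_converges_subseq[OF assms(2) r(1)] by blast
qed

text \<open>By monotone convergence the series of absolute values has finite integral, hence is
  finite almost everywhere.\<close>

lemma AE_summable_if_integrals_summable:
  fixes f :: "nat \<Rightarrow> 'a \<Rightarrow> real"
  assumes int: "\<And>i. integrable M (f i)" and sums: "summable (\<lambda>i. \<integral>x. \<bar>f i x\<bar> \<partial>M)"
  shows "AE x in M. summable (\<lambda>i. \<bar>f i x\<bar>)"
proof -
  note [measurable] = borel_measurable_integrable[OF int]
  have "(\<integral>\<^sup>+x. (\<Sum>i. ennreal \<bar>f i x\<bar>) \<partial>M) = (\<Sum>i. \<integral>\<^sup>+x. ennreal \<bar>f i x\<bar> \<partial>M)"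
    by (intro nn_integral_suminf) measurable
  also have "\<dots> = (\<Sum>i. ennreal (\<integral>x. \<bar>f i x\<bar> \<partial>M))"
    by (intro arg_cong[where f = suminf] ext nn_integral_eq_integral integrable_abs int) auto
  also have "\<dots> < \<infinity>"
    using sums by (simp add: ennreal_suminf_neq_top less_top[symmetric] integral_nonneg_AE)
  finally have "AE x in M. (\<Sum>i. ennreal \<bar>f i x\<bar>) \<noteq> \<infinity>"
    by (intro nn_integral_noteq_infinite) auto
  then show ?thesis
  proof eventually_elim
    case (elim x)
    show ?case
      by (rule summable_suminf_not_top) (use elim in auto)
  qed
qed

lemma integral_series_remainder_tendsto_0:
  fixes f :: "nat \<Rightarrow> 'a \<Rightarrow> real"
  assumes int: "\<And>i. integrable M (f i)" and sums: "summable (\<lambda>i. \<integral>x. \<bar>f i x\<bar> \<partial>M)"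
  shows "integrable M (\<lambda>x. \<Sum>i. f i x)"
    and "(\<lambda>n. \<integral>x. \<bar>(\<Sum>i<n. f i x) - (\<Sum>i. f i x)\<bar> \<partial>M) \<longlonglongrightarrow> 0"
proof -
  note [measurable] = borel_measurable_integrable[OF int]
  have ae: "AE x in M. summable (\<lambda>i. \<bar>f i x\<bar>)"
    by (rule AE_summable_if_integrals_summable[OF assms])
  show 1: "integrable M (\<lambda>x. \<Sum>i. f i x)"
    by (rule integrable_suminf[OF int]) (simp_all add: ae sums)
  have 2: "integrable M (\<lambda>x. \<Sum>i. \<bar>f i x\<bar>)"
    by (rule integrable_suminf[OF integrable_abs[OF int]]) (simp_all add: ae sums)
  define s where "s n x = \<bar>(\<Sum>i<n. f i x) - (\<Sum>i. f i x)\<bar>" for n x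
  \<comment> \<open>The dominating function: one copy of the absolute series bounds the partial sum,
    the other the full sum.\<close>
  define w where "w x = (\<Sum>i. \<bar>f i x\<bar>) + (\<Sum>i. \<bar>f i x\<bar>)" for x
  have "(\<lambda>n. integral\<^sup>L M (s n)) \<longlonglongrightarrow> integral\<^sup>L M (\<lambda>x. 0)"
  proof (rule integral_dominated_convergence)
    show "integrable M w"
      unfolding w_def using 2 by (intro Bochner_Integration.integrable_add)
    show "s n \<in> borel_measurable M" for n
      unfolding s_def using borel_measurable_integrable[OF 1] by measurable
    show "AE x in M. (\<lambda>n. s n x) \<longlonglongrightarrow> 0"
      using ae
    proof eventually_elim
      case (elim x)
      then have "(\<lambda>n. (\<Sum>i<n. f i x) - (\<Sum>i. f i x)) \<longlonglongrightarrow> 0"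
        by (rule LIM_zero[OF summable_LIMSEQ[OF summable_rabs_cancel]])
      then show ?case unfolding s_def by (rule tendsto_rabs_zero)
    qed
    show "AE x in M. norm (s n x) \<le> w x" for n
      using ae
    proof eventually_elim
      case (elim x)
      have "\<bar>\<Sum>i<n. f i x\<bar> \<le> (\<Sum>i<n. \<bar>f i x\<bar>)" by (rule sum_abs)
      also have "\<dots> \<le> (\<Sum>i. \<bar>f i x\<bar>)" using elim by (intro sum_le_suminf) auto
      finally have "s n x \<le> w x"
        unfolding s_def w_def using summable_rabs[OF elim] by linarith
      then show ?case by (simp add: s_def)
    qed
  qed simp
  then show "(\<lambda>n. \<integral>x. \<bar>(\<Sum>i<n. f i x) - (\<Sum>i. f i x)\<bar> \<partial>M) \<longlonglongrightarrow> 0"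
    by (simp add: s_def[abs_def])
qed

text \<open>As an instance of \<^class>\<open>banach\<close>, the space is accessible to the library on normed spaces.\<close>

typedef l1_real = "carrier (L1 (lborel :: real measure))"
  by (auto simp: L1_def quotient_def intro!: exI[of _ "\<lambda>x. 0"])

definition l1_class :: "(real \<Rightarrow> real) \<Rightarrow> l1_real" where
  "l1_class f = Abs_l1_real (ae_eq lborel `` {f})"

lemma Rep_l1_class: "integrable lborel f \<Longrightarrow> Rep_l1_real (l1_class f) = ae_eq lborel `` {f}"
  unfolding l1_class_def by (rule Abs_l1_real_inverse) (auto simp: L1_def quotient_def)

lemma l1_class_cases:
  obtains f where "integrable lborel f" "v = l1_class f"
proof -
  have "Rep_l1_real v \<in> {f. integrable lborel f} // ae_eq lborel"
    using Rep_l1_real[of v] by (simp add: L1_def)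
  then obtain f where "integrable lborel f" "Rep_l1_real v = ae_eq lborel `` {f}"
    by (auto elim: quotientE)
  then show thesis
    using that[of f] Rep_l1_real_inverse[of v] by (simp add: l1_class_def)
qed

lemma l1_class_eq_iff:
  assumes "integrable lborel f" "integrable lborel g"
  shows "l1_class f = l1_class g \<longleftrightarrow> (AE x in lborel. f x = g x)"
proof -
  have "l1_class f = l1_class g \<longleftrightarrow> ae_eq lborel `` {f} = ae_eq lborel `` {g}"
    using assms by (simp add: Rep_l1_real_inject[symmetric] Rep_l1_class)
  also have "\<dots> \<longleftrightarrow> (f, g) \<in> ae_eq lborel"
    using assms by (intro eq_equiv_class_iff[OF equiv_ae_eq]) auto
  finally show ?thesis using assms by (simp add: ae_eq_def)
qed

instantiation l1_real :: real_vector
begin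

definition "0 = l1_class (\<lambda>x. 0)"
definition "v + w = Abs_l1_real (vadd (L1 lborel) (Rep_l1_real v) (Rep_l1_real w))"
definition "r *\<^sub>R v = Abs_l1_real (vscale (L1 lborel) r (Rep_l1_real v))"
text \<open>This agrees with the way \<open>vdist\<close> forms differences.\<close>

definition "- (v :: l1_real) = (-1) *\<^sub>R v"
definition "v - w = v + - (w :: l1_real)"

lemma l1_class_add:
  "integrable lborel f \<Longrightarrow> integrable lborel g \<Longrightarrow>
    l1_class f + l1_class g = l1_class (\<lambda>x. f x + g x)"
  by (simp add: plus_l1_real_def Rep_l1_class L1_vadd_class) (simp add: l1_class_def)

lemma l1_class_scaleR:
  "integrable lborel f \<Longrightarrow> r *\<^sub>R l1_class f = l1_class (\<lambda>x. r * f x)"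
  by (simp add: scaleR_l1_real_def Rep_l1_class L1_vscale_class) (simp add: l1_class_def)

instance
proof
  fix u v w :: l1_real and r s :: real
  obtain f where f: "integrable lborel f" "u = l1_class f" by (rule l1_class_cases)
  obtain g where g: "integrable lborel g" "v = l1_class g" by (rule l1_class_cases)
  obtain h where h: "integrable lborel h" "w = l1_class h" by (rule l1_class_cases)
  note rules = f g h l1_class_add l1_class_scaleR zero_l1_real_def uminus_l1_real_def
  show "u + v + w = u + (v + w)" by (simp add: rules add.assoc)
  show "u + v = v + u" by (simp add: rules add.commute)
  show "0 + u = u" by (simp add: rules)
  show "- u + u = 0" by (simp add: rules)
  show "u - v = u + - v" by (rule minus_l1_real_def)
  show "r *\<^sub>R (u + v) = r *\<^sub>R u + r *\<^sub>R v" by (simp add: rules distrib_left)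
  show "(r + s) *\<^sub>R u = r *\<^sub>R u + s *\<^sub>R u" by (simp add: rules distrib_right)
  show "r *\<^sub>R s *\<^sub>R u = (r * s) *\<^sub>R u" by (simp add: rules mult.assoc)
  show "1 *\<^sub>R u = u" by (simp add: rules)
qed

end

instantiation l1_real :: real_normed_vector
begin

definition "norm v = vnorm (L1 lborel) (Rep_l1_real v)"
definition "sgn (v :: l1_real) = v /\<^sub>R norm v"
definition "dist v w = norm (v - w :: l1_real)"
definition [code del]:
  "(uniformity :: (l1_real \<times> l1_real) filter) = (INF e\<in>{0 <..}. principal {(x, y). dist x y < e})"
definition [code del]:
  "open (S :: l1_real set) \<longleftrightarrow> (\<forall>x\<in>S. \<forall>\<^sub>F (x', y) in uniformity. x' = x \<longrightarrow> y \<in> S)"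

lemma norm_l1_class:
  "integrable lborel f \<Longrightarrow> norm (l1_class f) = (\<integral>x. \<bar>f x\<bar> \<partial>lborel)"
  by (simp add: norm_l1_real_def Rep_l1_class L1_vnorm_class)

instance
proof
  fix u v :: l1_real and r :: real
  obtain f where f: "integrable lborel f" "u = l1_class f" by (rule l1_class_cases)
  obtain g where g: "integrable lborel g" "v = l1_class g" by (rule l1_class_cases)
  have "norm u = 0 \<longleftrightarrow> (AE x in lborel. \<bar>f x\<bar> = 0)"
    unfolding f(2) norm_l1_class[OF f(1)]
    by (rule integral_nonneg_eq_0_iff_AE) (use f(1) in auto)
  then show "norm u = 0 \<longleftrightarrow> u = 0"
    using f by (simp add: zero_l1_real_def l1_class_eq_iff)
  have "(\<integral>x. \<bar>f x + g x\<bar> \<partial>lborel) \<le> (\<integral>x. \<bar>f x\<bar> + \<bar>g x\<bar> \<partial>lborel)"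
    using f g by (intro integral_mono) auto
  then show "norm (u + v) \<le> norm u + norm v"
    using f g by (simp add: l1_class_add norm_l1_class)
  show "norm (r *\<^sub>R u) = \<bar>r\<bar> * norm u"
    using f by (simp add: l1_class_scaleR norm_l1_class abs_mult)
qed (rule sgn_l1_real_def dist_l1_real_def uniformity_l1_real_def open_l1_real_def)+

end

lemma l1_class_sum:
  assumes "\<And>i. i \<in> F \<Longrightarrow> integrable lborel (f i)"
  shows "(\<Sum>i\<in>F. l1_class (f i)) = l1_class (\<lambda>x. \<Sum>i\<in>F. f i x)"
  using assms by (induction F rule: infinite_finite_induct) (auto simp: zero_l1_real_def l1_class_add)

lemma l1_class_diff:
  "integrable lborel f \<Longrightarrow> integrable lborel g \<Longrightarrow>
    l1_class f - l1_class g = l1_class (\<lambda>x. f x - g x)"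
  using l1_class_scaleR[of g "-1"] l1_class_add[of f "\<lambda>x. - g x"]
  by (simp add: diff_conv_add_uminus del: add_uminus_conv_diff)

instance l1_real :: banach
proof
  fix X :: "nat \<Rightarrow> l1_real"
  assume "Cauchy X"
  show "convergent X"
  proof (rule Cauchy_convergent_if_abs_summable[OF _ \<open>Cauchy X\<close>])
    fix h :: "nat \<Rightarrow> l1_real"
    assume summable: "summable (\<lambda>n. norm (h n))"
    have "\<forall>n. \<exists>f. integrable lborel f \<and> h n = l1_class f"
      by (metis l1_class_cases)
    then obtain f where f: "\<And>n. integrable lborel (f n)" "\<And>n. h n = l1_class (f n)"
      by metis
    have sums: "summable (\<lambda>n. \<integral>x. \<bar>f n x\<bar> \<partial>lborel)"
      using summable f by (simp add: norm_l1_class)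
    \<comment> \<open>The limit is the class of the pointwise sum. Where the series diverges
      \<open>suminf\<close> is unspecified, but this happens only on a null set.\<close>
    note lim = integral_series_remainder_tendsto_0[OF f(1) sums]
    have "norm ((\<Sum>i<n. h i) - l1_class (\<lambda>x. \<Sum>i. f i x)) =
        (\<integral>x. \<bar>(\<Sum>i<n. f i x) - (\<Sum>i. f i x)\<bar> \<partial>lborel)" for n
      using f lim(1) by (simp add: l1_class_sum l1_class_diff norm_l1_class)
    then have "(\<lambda>n. norm ((\<Sum>i<n. h i) - l1_class (\<lambda>x. \<Sum>i. f i x))) \<longlonglongrightarrow> 0"
      using lim(2) by simp
    then have "(\<lambda>n. \<Sum>i<n. h i) \<longlonglongrightarrow> l1_class (\<lambda>x. \<Sum>i. f i x)"
      by (rule LIM_zero_cancel[OF tendsto_norm_zero_cancel])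
    then show "summable h"
      by (auto simp: summable_def sums_def)
  qed
qed

section \<open>Transfer between the type and the normed space with explicit carrier\<close>

lemma Rep_l1_real_add: "Rep_l1_real (v + w) = vadd (L1 lborel) (Rep_l1_real v) (Rep_l1_real w)"
proof -
  obtain f where f: "integrable lborel f" "v = l1_class f" by (rule l1_class_cases)
  obtain g where g: "integrable lborel g" "w = l1_class g" by (rule l1_class_cases)
  show ?thesis using f g by (simp add: l1_class_add Rep_l1_class L1_vadd_class)
qed

lemma Rep_l1_real_scaleR: "Rep_l1_real (r *\<^sub>R v) = vscale (L1 lborel) r (Rep_l1_real v)"
proof -
  obtain f where f: "integrable lborel f" "v = l1_class f" by (rule l1_class_cases)
  show ?thesis using f by (simp add: l1_class_scaleR Rep_l1_class L1_vscale_class)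
qed

lemma Rep_l1_real_zero: "Rep_l1_real 0 = vzero (L1 lborel)"
  by (simp add: zero_l1_real_def Rep_l1_class L1_def)

lemma vdist_Rep_l1_real: "vdist (L1 lborel) (Rep_l1_real v) (Rep_l1_real w) = dist v w"
  by (simp add: vdist_def dist_norm norm_l1_real_def flip: Rep_l1_real_add Rep_l1_real_scaleR)

text \<open>The injection \<open>h\<close> allows the estimates to be applied to a family and to its
  left translates with the same coefficients \<open>f\<close>.\<close>

proposition ex_l1_real_representation:
  fixes b :: "'g \<Rightarrow> 'a::real_inner"
  assumes A: "countable A"
  obtains \<Phi> :: "'g \<Rightarrow> l1_real" where
    "\<And>(F :: 'g set) h f. finite F \<Longrightarrow> inj_on h F \<Longrightarrow> h ` F \<subseteq> A \<Longrightarrow>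
      norm (\<Sum>x\<in>F. f x *\<^sub>R \<Phi> (h x)) \<le> norm (\<Sum>x\<in>F. f x *\<^sub>R b (h x)) + (\<Sum>x\<in>F. \<bar>f x\<bar>)"
    "\<And>(F :: 'g set) h f. finite F \<Longrightarrow> inj_on h F \<Longrightarrow> h ` F \<subseteq> A \<Longrightarrow>
      norm (\<Sum>x\<in>F. f x *\<^sub>R b (h x)) / 4 + (\<Sum>x\<in>F. \<bar>f x\<bar>) \<le> norm (\<Sum>x\<in>F. f x *\<^sub>R \<Phi> (h x))"
proof -
  \<comment> \<open>If \<open>A\<close> is finite, indices outside the range of
    \<open>to_nat_on A\<close> yield a default element; the sums below never reach them.\<close>
  define v where "v n = b (from_nat_into A n)" for n
  obtain \<Psi> :: "nat \<Rightarrow> real \<Rightarrow> real" where int: "\<And>n. integrable lborel (\<Psi> n)"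
    and upper: "\<And>F f. finite F \<Longrightarrow> (\<integral>x. \<bar>\<Sum>n\<in>F. f n * \<Psi> n x\<bar> \<partial>lborel)
        \<le> norm (\<Sum>n\<in>F. f n *\<^sub>R v n) + (\<Sum>n\<in>F. \<bar>f n\<bar>)"
    and lower: "\<And>F f. finite F \<Longrightarrow> norm (\<Sum>n\<in>F. f n *\<^sub>R v n) / 4 + (\<Sum>n\<in>F. \<bar>f n\<bar>)
        \<le> (\<integral>x. \<bar>\<Sum>n\<in>F. f n * \<Psi> n x\<bar> \<partial>lborel)"
    by (rule ex_L1_representation[of v]) (rule that)
  define \<Phi> where "\<Phi> x = l1_class (\<Psi> (to_nat_on A x))" for x
  \<comment> \<open>Sums over \<open>F\<close> become sums over natural numbers along the injective
    map \<open>k\<close>, through which the coefficients are pulled back.\<close>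
  have *: "\<exists>F' f'. finite F' \<and>
      norm (\<Sum>x\<in>F. f x *\<^sub>R \<Phi> (h x)) = (\<integral>x. \<bar>\<Sum>n\<in>F'. f' n * \<Psi> n x\<bar> \<partial>lborel) \<and>
      (\<Sum>x\<in>F. f x *\<^sub>R b (h x)) = (\<Sum>n\<in>F'. f' n *\<^sub>R v n) \<and> (\<Sum>x\<in>F. \<bar>f x\<bar>) = (\<Sum>n\<in>F'. \<bar>f' n\<bar>)"
    if F: "finite F" and h: "inj_on h F" "h ` F \<subseteq> A" for F h and f :: "'g \<Rightarrow> real"
  proof -
    define k where "k x = to_nat_on A (h x)" for x
    have k: "inj_on k F"
      using comp_inj_on[OF h(1) inj_on_subset[OF inj_on_to_nat_on[OF A] h(2)]]
      by (simp add: k_def[abs_def] comp_def)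
    define f' where "f' n = f (inv_into F k n)" for n
    have f': "f' (k x) = f x" if "x \<in> F" for x
      using that k by (simp add: f'_def)
    have v: "v (k x) = b (h x)" if "x \<in> F" for x
      using that h(2) A by (auto simp: v_def k_def)
    have "(\<Sum>x\<in>F. f x *\<^sub>R \<Phi> (h x)) = (\<Sum>n\<in>k ` F. f' n *\<^sub>R l1_class (\<Psi> n))"
      unfolding sum.reindex[OF k] by (intro sum.cong) (simp_all add: f' \<Phi>_def flip: k_def)
    also have "\<dots> = l1_class (\<lambda>x. \<Sum>n\<in>k ` F. f' n * \<Psi> n x)"
      using int by (simp add: l1_class_scaleR l1_class_sum)
    finally have "norm (\<Sum>x\<in>F. f x *\<^sub>R \<Phi> (h x)) = (\<integral>x. \<bar>\<Sum>n\<in>k ` F. f' n * \<Psi> n x\<bar> \<partial>lborel)"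
      using int by (simp add: norm_l1_class)
    moreover have "(\<Sum>x\<in>F. f x *\<^sub>R b (h x)) = (\<Sum>n\<in>k ` F. f' n *\<^sub>R v n)"
      unfolding sum.reindex[OF k] by (intro sum.cong) (auto simp: f' v)
    moreover have "(\<Sum>x\<in>F. \<bar>f x\<bar>) = (\<Sum>n\<in>k ` F. \<bar>f' n\<bar>)"
      unfolding sum.reindex[OF k] by (intro sum.cong) (auto simp: f')
    ultimately show ?thesis using F by blast
  qed
  show thesis
  proof (rule that[of \<Phi>])
    fix F :: "'g set" and h and f :: "'g \<Rightarrow> real"
    assume "finite F" "inj_on h F" "h ` F \<subseteq> A"
    from *[OF this, of f] obtain F' f' where "finite F'"
      "norm (\<Sum>x\<in>F. f x *\<^sub>R \<Phi> (h x)) = (\<integral>x. \<bar>\<Sum>n\<in>F'. f' n * \<Psi> n x\<bar> \<partial>lborel)"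
      "(\<Sum>x\<in>F. f x *\<^sub>R b (h x)) = (\<Sum>n\<in>F'. f' n *\<^sub>R v n)" "(\<Sum>x\<in>F. \<bar>f x\<bar>) = (\<Sum>n\<in>F'. \<bar>f' n\<bar>)"
      by blast
    with upper[of F' f'] lower[of F' f']
    show "norm (\<Sum>x\<in>F. f x *\<^sub>R \<Phi> (h x)) \<le> norm (\<Sum>x\<in>F. f x *\<^sub>R b (h x)) + (\<Sum>x\<in>F. \<bar>f x\<bar>)"
      and "norm (\<Sum>x\<in>F. f x *\<^sub>R b (h x)) / 4 + (\<Sum>x\<in>F. \<bar>f x\<bar>) \<le> norm (\<Sum>x\<in>F. f x *\<^sub>R \<Phi> (h x))"
      by simp_all
  qed
qed

section \<open>Extending translations to the closed span\<close>

lemma subspace_closure: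
  fixes D :: "'a::real_normed_vector set"
  assumes "subspace D"
  shows "subspace (closure D)"
proof (rule subspaceI)
  show "0 \<in> closure D"
    using closure_subset subspace_0[OF assms] by blast
next
  fix v w assume "v \<in> closure D" "w \<in> closure D"
  then obtain x y where x: "\<And>n. x n \<in> D" "x \<longlonglongrightarrow> v" and y: "\<And>n. y n \<in> D" "y \<longlonglongrightarrow> w"
    unfolding closure_sequential by metis
  have "(\<lambda>n. x n + y n) \<longlonglongrightarrow> v + w" "\<And>n. x n + y n \<in> D"
    by (rule tendsto_add[OF x(2) y(2)]) (rule subspace_add[OF assms x(1) y(1)])
  then show "v + w \<in> closure D"
    unfolding closure_sequential by (intro exI[of _ "\<lambda>n. x n + y n"]) auto
next
  fix c v assume "v \<in> closure D"
  then obtain x where x: "\<And>n. x n \<in> D" "x \<longlonglongrightarrow> v"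
    unfolding closure_sequential by metis
  have "(\<lambda>n. c *\<^sub>R x n) \<longlonglongrightarrow> c *\<^sub>R v" "\<And>n. c *\<^sub>R x n \<in> D"
    by (rule tendsto_scaleR[OF tendsto_const x(2)]) (rule subspace_scale[OF assms x(1)])
  then show "c *\<^sub>R v \<in> closure D"
    unfolding closure_sequential by (intro exI[of _ "\<lambda>n. c *\<^sub>R x n"]) auto
qed

lemma eq_on_closure:
  fixes f g :: "'a::first_countable_topology \<Rightarrow> 'b::t2_space"
  assumes f: "continuous_on (closure D) f" and g: "continuous_on (closure D) g"
    and eq: "\<And>v. v \<in> D \<Longrightarrow> f v = g v" and v: "v \<in> closure D"
  shows "f v = g v"
proof -
  obtain x where x: "\<And>n. x n \<in> D" "x \<longlonglongrightarrow> v"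
    using v unfolding closure_sequential by metis
  have in_closure: "\<forall>\<^sub>F n in sequentially. x n \<in> closure D"
    using x(1) closure_subset by (intro always_eventually) blast
  have "(\<lambda>n. f (x n)) \<longlonglongrightarrow> f v"
    by (rule continuous_on_tendsto_compose[OF f x(2) v in_closure])
  moreover have "(\<lambda>n. f (x n)) \<longlonglongrightarrow> g v"
    using continuous_on_tendsto_compose[OF g x(2) v in_closure] eq x(1) by simp
  ultimately show ?thesis by (rule LIMSEQ_unique)
qed

text \<open>A linear map bounded on \<open>D\<close> is Lipschitz there and extends continuously to
  the closure; linearity and the bound pass to limits of sequences from \<open>D\<close>. The map
  \<open>g\<close> is controlled on \<open>D\<close> alone and may be discontinuous
  elsewhere.\<close>

lemma bounded_linear_extension_to_closure:
  fixes g :: "'a::real_normed_vector \<Rightarrow> 'b::banach"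
  assumes D: "subspace D" and g: "linear g" and bound: "\<And>v. v \<in> D \<Longrightarrow> norm (g v) \<le> K * norm v"
  shows "\<exists>h. continuous_on (closure D) h \<and> (\<forall>v\<in>D. h v = g v) \<and>
    (\<forall>v\<in>closure D. \<forall>w\<in>closure D. h (v + w) = h v + h w) \<and>
    (\<forall>c. \<forall>v\<in>closure D. h (c *\<^sub>R v) = c *\<^sub>R h v) \<and>
    (\<forall>v\<in>closure D. norm (h v) \<le> K * norm v)"
proof -
  \<comment> \<open>A Lipschitz constant has to be nonnegative, which the absolute value
    ensures.\<close>
  have "dist (g v) (g w) \<le> \<bar>K\<bar> * dist v w" if "v \<in> D" "w \<in> D" for v w
  proof -
    have "dist (g v) (g w) \<le> K * norm (v - w)"
      using bound[OF subspace_diff[OF D that]] by (simp add: dist_norm linear_diff[OF g])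
    also have "\<dots> \<le> \<bar>K\<bar> * norm (v - w)" by (intro mult_right_mono) auto
    finally show ?thesis by (simp add: dist_norm)
  qed
  then have "\<bar>K\<bar>-lipschitz_on D g" by (auto intro: lipschitz_onI)
  then have "uniformly_continuous_on D g" by (rule lipschitz_on_uniformly_continuous)
  then obtain h where h: "uniformly_continuous_on (closure D) h" "\<And>x. x \<in> D \<Longrightarrow> g x = h x"
    by (rule uniformly_continuous_on_extension_on_closure) blast
  have cont: "continuous_on (closure D) h"
    using h(1) by (rule uniformly_continuous_imp_continuous)
  have lim: "(\<lambda>n. g (x n)) \<longlonglongrightarrow> h v" if "\<And>n. x n \<in> D" "x \<longlonglongrightarrow> v" for x v
  proof -
    have "v \<in> closure D" using that unfolding closure_sequential by blast
    moreover have "\<forall>\<^sub>F n in sequentially. x n \<in> closure D"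
      using that(1) closure_subset by (intro always_eventually) blast
    ultimately have "(\<lambda>n. h (x n)) \<longlonglongrightarrow> h v"
      by (intro continuous_on_tendsto_compose[OF cont that(2)])
    then show ?thesis using h(2) that(1) by simp
  qed
  show ?thesis
  proof (intro exI[of _ h] conjI ballI allI)
    show "continuous_on (closure D) h" by (rule cont)
    show "h v = g v" if "v \<in> D" for v using h(2)[OF that] by simp
    fix v w assume "v \<in> closure D" "w \<in> closure D"
    then obtain x y where x: "\<And>n. x n \<in> D" "x \<longlonglongrightarrow> v" and y: "\<And>n. y n \<in> D" "y \<longlonglongrightarrow> w"
      unfolding closure_sequential by metis
    have "(\<lambda>n. g (x n + y n)) \<longlonglongrightarrow> h (v + w)"
      using x y by (intro lim tendsto_add subspace_add[OF D])
    moreover have "(\<lambda>n. g (x n + y n)) \<longlonglongrightarrow> h v + h w"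
      unfolding linear_add[OF g] using x y by (intro lim tendsto_add)
    ultimately show "h (v + w) = h v + h w" by (rule LIMSEQ_unique)
  next
    fix c v assume "v \<in> closure D"
    then obtain x where x: "\<And>n. x n \<in> D" "x \<longlonglongrightarrow> v"
      unfolding closure_sequential by metis
    have "(\<lambda>n. g (c *\<^sub>R x n)) \<longlonglongrightarrow> h (c *\<^sub>R v)"
      using x by (intro lim tendsto_scaleR tendsto_const subspace_scale[OF D])
    moreover have "(\<lambda>n. g (c *\<^sub>R x n)) \<longlonglongrightarrow> c *\<^sub>R h v"
      unfolding linear_scale[OF g] using x by (intro lim tendsto_scaleR tendsto_const)
    ultimately show "h (c *\<^sub>R v) = c *\<^sub>R h v" by (rule LIMSEQ_unique)
  next
    fix v assume "v \<in> closure D"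
    then obtain x where x: "\<And>n. x n \<in> D" "x \<longlonglongrightarrow> v"
      unfolding closure_sequential by metis
    show "norm (h v) \<le> K * norm v"
    proof (rule LIMSEQ_le)
      show "(\<lambda>n. norm (g (x n))) \<longlonglongrightarrow> norm (h v)"
        by (intro tendsto_norm lim x)
      show "(\<lambda>n. K * norm (x n)) \<longlonglongrightarrow> K * norm v"
        by (intro tendsto_mult_left tendsto_norm x)
    qed (use bound x(1) in auto)
  qed
qed

text \<open>If a combination vanishes, the bound forces the sum of the absolute values of its
  coefficients to vanish. Independence is what later allows a translation to be prescribed on the
  vectors \<open>\<Phi> x\<close>.\<close>

lemma independent_if_norm_ge:
  fixes \<Phi> :: "'i \<Rightarrow> 'a::real_normed_vector"
  assumes ge: "\<And>F f. finite F \<Longrightarrow> F \<subseteq> A \<Longrightarrow> (\<Sum>x\<in>F. \<bar>f x\<bar>) \<le> norm (\<Sum>x\<in>F. f x *\<^sub>R \<Phi> x)"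
  shows "inj_on \<Phi> A" and "independent (\<Phi> ` A)"
proof -
  show inj: "inj_on \<Phi> A"
  proof (rule inj_onI, rule ccontr)
    fix x y assume "x \<in> A" "y \<in> A" "\<Phi> x = \<Phi> y" "x \<noteq> y"
    then show False
      \<comment> \<open>With coefficients 1 and -1 the combination is 0, while the absolute values
        add up to 2.\<close>
      using ge[of "{x, y}" "\<lambda>z. if z = x then 1 else -1"] by simp
  qed
  have "\<forall>v\<in>S. u v = 0" if S: "S \<subseteq> \<Phi> ` A" "finite S" "(\<Sum>v\<in>S. u v *\<^sub>R v) = 0" for S u
  proof -
    obtain F where F: "F \<subseteq> A" "finite F" "S = \<Phi> ` F"
      using finite_subset_image[OF S(2,1)] by metis
    have "(\<Sum>x\<in>F. u (\<Phi> x) *\<^sub>R \<Phi> x) = 0"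
      using S(3) F inj_on_subset[OF inj F(1)] by (simp add: sum.reindex)
    then have "(\<Sum>x\<in>F. \<bar>u (\<Phi> x)\<bar>) \<le> 0"
      using ge[OF F(2,1), of "\<lambda>x. u (\<Phi> x)"] by simp
    then have "(\<Sum>x\<in>F. \<bar>u (\<Phi> x)\<bar>) = 0"
      by (intro order_antisym sum_nonneg) auto
    then show ?thesis using F by (simp add: sum_nonneg_eq_0_iff)
  qed
  then show "independent (\<Phi> ` A)"
    unfolding independent_explicit_finite_subsets by (intro allI impI)
qed

text \<open>By independence some linear functional is 1 on every \<open>\<Phi> x\<close>. It
  annihilates the differences, and on a combination of the \<open>\<Phi> x\<close> it returns the
  sum of the coefficients.\<close>

lemma span_differences_cases:
  fixes \<Phi> :: "'i \<Rightarrow> 'a::real_vector"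
  assumes inj: "inj_on \<Phi> A" and ind: "independent (\<Phi> ` A)" and a: "a \<in> A"
    and v: "v \<in> span ((\<lambda>x. \<Phi> x - \<Phi> a) ` A)"
  obtains F f where "finite F" "F \<subseteq> A" "sum f F = 0" "v = (\<Sum>x\<in>F. f x *\<^sub>R \<Phi> x)"
proof -
  obtain l :: "'a \<Rightarrow> real" where l: "linear l" "\<And>x. x \<in> A \<Longrightarrow> l (\<Phi> x) = 1"
    using linear_independent_extend[OF ind, of "\<lambda>_. 1"] by auto
  have "l v = 0"
    by (rule linear_eq_0_on_span[OF l(1) _ v]) (auto simp: linear_diff[OF l(1)] l(2) a)
  have "span ((\<lambda>x. \<Phi> x - \<Phi> a) ` A) \<subseteq> span (\<Phi> ` A)"
    by (intro span_minimal image_subsetI span_diff span_base imageI a) auto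
  then obtain T u where T: "finite T" "T \<subseteq> \<Phi> ` A" "v = (\<Sum>b\<in>T. u b *\<^sub>R b)"
    using v unfolding span_explicit[of "\<Phi> ` A"] by auto
  then obtain F where F: "F \<subseteq> A" "finite F" "T = \<Phi> ` F"
    using finite_subset_image[OF T(1,2)] by metis
  have v': "v = (\<Sum>x\<in>F. u (\<Phi> x) *\<^sub>R \<Phi> x)"
    using T(3) F inj_on_subset[OF inj F(1)] by (simp add: sum.reindex)
  have "l v = (\<Sum>x\<in>F. u (\<Phi> x))"
    unfolding v' linear_sum[OF l(1)] using F l by (intro sum.cong) (auto simp: linear_scale)
  then show thesis
    using that[OF F(2,1) _ v'] \<open>l v = 0\<close> by simp
qed

text \<open>Independence gives linear maps sending \<open>\<Phi> x\<close> to
  \<open>\<Phi> (s \<otimes> x)\<close>. They are bounded on combinations with coefficient sum 0,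
  that is, on the span of differences, and are extended from there to its closure. The action laws
  hold on generators and follow by linearity and continuity.\<close>

proposition shift_extends_to_closed_span:
  fixes G (structure) and \<Phi> :: "'g \<Rightarrow> 'e::banach"
  assumes "group G"
    and ge: "\<And>F f. finite F \<Longrightarrow> F \<subseteq> carrier G \<Longrightarrow> (\<Sum>x\<in>F. \<bar>f x\<bar>) \<le> norm (\<Sum>x\<in>F. f x *\<^sub>R \<Phi> x)"
    and shift: "\<And>s F f. s \<in> carrier G \<Longrightarrow> finite F \<Longrightarrow> F \<subseteq> carrier G \<Longrightarrow> sum f F = 0 \<Longrightarrow>
      norm (\<Sum>x\<in>F. f x *\<^sub>R \<Phi> (s \<otimes> x)) \<le> K * norm (\<Sum>x\<in>F. f x *\<^sub>R \<Phi> x)"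
  defines "E \<equiv> closure (span ((\<lambda>x. \<Phi> x - \<Phi> \<one>) ` carrier G))"
  obtains P where
    "\<And>s v. s \<in> carrier G \<Longrightarrow> v \<in> E \<Longrightarrow> P s v \<in> E"
    "\<And>s v w. s \<in> carrier G \<Longrightarrow> v \<in> E \<Longrightarrow> w \<in> E \<Longrightarrow> P s (v + w) = P s v + P s w"
    "\<And>s c v. s \<in> carrier G \<Longrightarrow> v \<in> E \<Longrightarrow> P s (c *\<^sub>R v) = c *\<^sub>R P s v"
    "\<And>s v. s \<in> carrier G \<Longrightarrow> v \<in> E \<Longrightarrow> norm (P s v) \<le> K * norm v"
    "\<And>s t v. s \<in> carrier G \<Longrightarrow> t \<in> carrier G \<Longrightarrow> v \<in> E \<Longrightarrow> P (s \<otimes> t) v = P s (P t v)"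
    "\<And>v. v \<in> E \<Longrightarrow> P \<one> v = v"
    "\<And>s x. s \<in> carrier G \<Longrightarrow> x \<in> carrier G \<Longrightarrow> P s (\<Phi> x - \<Phi> \<one>) = \<Phi> (s \<otimes> x) - \<Phi> s"
proof -
  interpret group G by fact
  have inj: "inj_on \<Phi> (carrier G)" and ind: "independent (\<Phi> ` carrier G)"
    using independent_if_norm_ge[of "carrier G" \<Phi>] ge by auto
  let ?B = "(\<lambda>x. \<Phi> x - \<Phi> \<one>) ` carrier G"
  \<comment> \<open>Translating a generator yields \<open>\<Phi> (s \<otimes> x) - \<Phi> s\<close>,
    a difference based at \<open>s\<close> instead of at \<open>\<one>\<close>.\<close>
  have base: "\<Phi> x - \<Phi> y \<in> span ?B" if "x \<in> carrier G" "y \<in> carrier G" for x y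
  proof -
    have "(\<Phi> x - \<Phi> \<one>) - (\<Phi> y - \<Phi> \<one>) \<in> span ?B"
      using that by (intro span_diff span_base) auto
    then show ?thesis by simp
  qed
  have "\<exists>g. linear g \<and> (\<forall>x\<in>carrier G. g (\<Phi> x) = \<Phi> (s \<otimes> x))" for s
  proof -
    obtain g where "linear g" "\<forall>b\<in>\<Phi> ` carrier G. g b = \<Phi> (s \<otimes> inv_into (carrier G) \<Phi> b)"
      using linear_independent_extend[OF ind, of "\<lambda>b. \<Phi> (s \<otimes> inv_into (carrier G) \<Phi> b)"]
      by (elim exE conjE)
    then show ?thesis by (intro exI[of _ g]) (simp add: inv_into_f_f[OF inj])
  qed
  then obtain g where g: "\<And>s. linear (g s)"
      "\<And>s x. x \<in> carrier G \<Longrightarrow> g s (\<Phi> x) = \<Phi> (s \<otimes> x)"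
    by metis
  have bound: "norm (g s v) \<le> K * norm v" if s: "s \<in> carrier G" and v: "v \<in> span ?B" for s v
  proof -
    obtain F f where F: "finite F" "F \<subseteq> carrier G" "sum f F = 0" "v = (\<Sum>x\<in>F. f x *\<^sub>R \<Phi> x)"
      using span_differences_cases[OF inj ind one_closed v] by blast
    have "g s v = (\<Sum>x\<in>F. f x *\<^sub>R \<Phi> (s \<otimes> x))"
      unfolding F(4) linear_sum[OF g(1)]
      using F(2) g by (intro sum.cong) (auto simp: linear_scale)
    then show ?thesis using shift[OF s F(1-3)] F(4) by simp
  qed
  have g_span: "g s v \<in> span ?B" if s: "s \<in> carrier G" and v: "v \<in> span ?B" for s v
  proof -
    have "g s ` ?B \<subseteq> span ?B"
      using s base by (auto simp: linear_diff[OF g(1)] g(2))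
    then have "g s ` span ?B \<subseteq> span ?B"
      unfolding linear_span_image[OF g(1), symmetric] by (intro span_minimal) auto
    then show ?thesis using v by blast
  qed
  define extends where "extends s h \<longleftrightarrow> continuous_on E h \<and> (\<forall>v\<in>span ?B. h v = g s v) \<and>
      (\<forall>v\<in>E. \<forall>w\<in>E. h (v + w) = h v + h w) \<and> (\<forall>c. \<forall>v\<in>E. h (c *\<^sub>R v) = c *\<^sub>R h v) \<and>
      (\<forall>v\<in>E. norm (h v) \<le> K * norm v)" for s and h :: "'e \<Rightarrow> 'e"
  have "\<forall>s\<in>carrier G. \<exists>h. extends s h"
    using bounded_linear_extension_to_closure[of "span ?B" "g _" K] g(1) bound
    unfolding E_def extends_def by simp
  then obtain P where "\<forall>s\<in>carrier G. extends s (P s)" by metis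
  then have P: "\<And>s. s \<in> carrier G \<Longrightarrow> continuous_on E (P s)"
    "\<And>s v. s \<in> carrier G \<Longrightarrow> v \<in> span ?B \<Longrightarrow> P s v = g s v"
    "\<And>s v w. s \<in> carrier G \<Longrightarrow> v \<in> E \<Longrightarrow> w \<in> E \<Longrightarrow> P s (v + w) = P s v + P s w"
    "\<And>s c v. s \<in> carrier G \<Longrightarrow> v \<in> E \<Longrightarrow> P s (c *\<^sub>R v) = c *\<^sub>R P s v"
    "\<And>s v. s \<in> carrier G \<Longrightarrow> v \<in> E \<Longrightarrow> norm (P s v) \<le> K * norm v"
    by (simp_all add: extends_def)
  have P_image: "P s ` E \<subseteq> E" if "s \<in> carrier G" for s
    unfolding E_def
  proof (rule image_closure_subset)
    show "continuous_on (closure (span ?B)) (P s)" using P(1)[OF that] by (simp add: E_def)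
    show "P s ` span ?B \<subseteq> closure (span ?B)"
      using g_span[OF that] closure_subset[of "span ?B"] by (auto simp: P(2)[OF that])
  qed simp
  show thesis
  proof (rule that[of P])
    fix s t v assume st: "s \<in> carrier G" "t \<in> carrier G" and v: "v \<in> E"
    show "P (s \<otimes> t) v = P s (P t v)"
    \<comment> \<open>Both sides are continuous on \<open>E\<close>, so they are compared on the
      span, where linearity reduces the comparison to generators.\<close>
    proof (rule eq_on_closure[of "span ?B" "P (s \<otimes> t)" "\<lambda>v. P s (P t v)"])
      show "continuous_on (closure (span ?B)) (P (s \<otimes> t))"
        using P(1) st by (simp add: E_def)
      show "continuous_on (closure (span ?B)) (\<lambda>v. P s (P t v))"
        using continuous_on_compose2[OF P(1)[OF st(1)] P(1)[OF st(2)] P_image[OF st(2)]]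
        by (simp add: E_def)
      show "v \<in> closure (span ?B)" using v by (simp add: E_def)
      fix w assume w: "w \<in> span ?B"
      have "g (s \<otimes> t) w = (g s \<circ> g t) w"
      proof (rule linear_eq_on_span[OF _ _ _ w])
        show "linear (g s \<circ> g t)" using g(1) by (intro linear_compose)
        fix b assume "b \<in> ?B"
        then show "g (s \<otimes> t) b = (g s \<circ> g t) b"
          using st by (auto simp: linear_diff[OF g(1)] g(2) m_assoc)
      qed (rule g(1))
      then show "P (s \<otimes> t) w = P s (P t w)"
        using st w g_span by (simp add: P(2))
    qed
  next
    fix v assume v: "v \<in> E"
    show "P \<one> v = v"
    proof (rule eq_on_closure[of "span ?B" "P \<one>" "\<lambda>v. v"])
      show "continuous_on (closure (span ?B)) (P \<one>)" using P(1) by (simp add: E_def)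
      show "v \<in> closure (span ?B)" using v by (simp add: E_def)
      fix w assume w: "w \<in> span ?B"
      have "g \<one> w = id w"
      proof (rule linear_eq_on_span[OF _ _ _ w])
        fix b assume "b \<in> ?B"
        then show "g \<one> b = id b" by (auto simp: linear_diff[OF g(1)] g(2))
      qed (rule g(1), rule linear_id)
      then show "P \<one> w = w" using w by (simp add: P(2))
    qed (rule continuous_on_id)
  next
    fix s x assume "s \<in> carrier G" "x \<in> carrier G"
    then show "P s (\<Phi> x - \<Phi> \<one>) = \<Phi> (s \<otimes> x) - \<Phi> s"
      using base by (simp add: P(2) linear_diff[OF g(1)] g(2))
  next
    show "P s v \<in> E" if "s \<in> carrier G" "v \<in> E" for s v
      using P_image that by blast
  qed (fact P(3) P(4) P(5))+
qed

section \<open>The affine action\<close>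

abbreviation (input) "subspace_l1 E \<equiv> L1 lborel\<lparr>carrier := Rep_l1_real ` E\<rparr>"

lemma closed_subspace_Rep_l1_real:
  assumes "subspace E" "closed E"
  shows "closed_subspace (Rep_l1_real ` E) (L1 lborel)"
  unfolding closed_subspace_def
proof (intro conjI ballI allI impI)
  show "Rep_l1_real ` E \<subseteq> carrier (L1 lborel)"
    using Rep_l1_real by blast
  show "vzero (L1 lborel) \<in> Rep_l1_real ` E"
    using subspace_0[OF assms(1)] by (simp flip: Rep_l1_real_zero)
  show "vadd (L1 lborel) X Y \<in> Rep_l1_real ` E"
    if "X \<in> Rep_l1_real ` E" "Y \<in> Rep_l1_real ` E" for X Y
    using that subspace_add[OF assms(1)] by (auto simp flip: Rep_l1_real_add)
  show "vscale (L1 lborel) r X \<in> Rep_l1_real ` E" if "X \<in> Rep_l1_real ` E" for r X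
    using that subspace_scale[OF assms(1)] by (auto simp flip: Rep_l1_real_scaleR)
  fix X assume "X \<in> carrier (L1 (lborel :: real measure))"
    and *: "\<forall>e>0. \<exists>Y\<in>Rep_l1_real ` E. vdist (L1 lborel) Y X < e"
  then obtain v where v: "X = Rep_l1_real v"
    using Rep_l1_real_cases by blast
  have "v \<in> closure E"
    unfolding closure_approachable using * by (auto simp: v vdist_Rep_l1_real)
  then show "X \<in> Rep_l1_real ` E" using assms(2) v by simp
qed

text \<open>The operator \<open>T\<close> is described only by its values on the image of
  \<open>E\<close>, so that the lemma covers both the action of \<open>s\<close> and its
  \<open>inv_into\<close>.\<close>

lemma bounded_linear_op_Rep_l1_real:
  assumes "\<And>v. v \<in> E \<Longrightarrow> T (Rep_l1_real v) = Rep_l1_real (P v)"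
    and "\<And>v. v \<in> E \<Longrightarrow> P v \<in> E"
    and "\<And>v w. v \<in> E \<Longrightarrow> w \<in> E \<Longrightarrow> P (v + w) = P v + P w"
    and "\<And>c v. v \<in> E \<Longrightarrow> P (c *\<^sub>R v) = c *\<^sub>R P v"
    and "\<And>v. v \<in> E \<Longrightarrow> norm (P v) \<le> K * norm v"
    and E: "subspace E"
  shows "bounded_linear_op (subspace_l1 E) T"
  unfolding bounded_linear_op_def
proof (intro conjI ballI allI exI[of _ K])
  show "T \<in> carrier (subspace_l1 E) \<rightarrow> carrier (subspace_l1 E)"
    using assms by auto
  fix X assume "X \<in> carrier (subspace_l1 E)"
  then obtain v where v: "v \<in> E" "X = Rep_l1_real v" by auto
  show "vnorm (subspace_l1 E) (T X) \<le> K * vnorm (subspace_l1 E) X"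
    using v assms by (simp flip: norm_l1_real_def)
  show "T (vscale (subspace_l1 E) r X) = vscale (subspace_l1 E) r (T X)" for r
    using v assms subspace_scale[OF E v(1)] by (simp flip: Rep_l1_real_scaleR)
  fix Y assume "Y \<in> carrier (subspace_l1 E)"
  then obtain w where w: "w \<in> E" "Y = Rep_l1_real w" by auto
  show "T (vadd (subspace_l1 E) X Y) = vadd (subspace_l1 E) (T X) (T Y)"
    using v w assms subspace_add[OF E v(1) w(1)] by (simp flip: Rep_l1_real_add)
qed

lemma linear_action_hom_GL:
  fixes G (structure)
  assumes "group G" and E: "subspace E"
    and closed: "\<And>s v. s \<in> carrier G \<Longrightarrow> v \<in> E \<Longrightarrow> P s v \<in> E"
    and add: "\<And>s v w. s \<in> carrier G \<Longrightarrow> v \<in> E \<Longrightarrow> w \<in> E \<Longrightarrow> P s (v + w) = P s v + P s w"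
    and scale: "\<And>s c v. s \<in> carrier G \<Longrightarrow> v \<in> E \<Longrightarrow> P s (c *\<^sub>R v) = c *\<^sub>R P s v"
    and bound: "\<And>s v. s \<in> carrier G \<Longrightarrow> v \<in> E \<Longrightarrow> norm (P s v) \<le> K * norm v"
    and mult: "\<And>s t v. s \<in> carrier G \<Longrightarrow> t \<in> carrier G \<Longrightarrow> v \<in> E \<Longrightarrow> P (s \<otimes> t) v = P s (P t v)"
    and one: "\<And>v. v \<in> E \<Longrightarrow> P \<one> v = v"
  shows "(\<lambda>s. \<lambda>X\<in>Rep_l1_real ` E. Rep_l1_real (P s (Abs_l1_real X))) \<in> hom G (GL (subspace_l1 E))"
proof -
  interpret group G by fact
  let ?V = "subspace_l1 E" and ?E = "Rep_l1_real ` E"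
  \<comment> \<open>The restriction to \<open>?E\<close> is there because members of
    \<open>Bij\<close> are extensional functions.\<close>
  define T where "T s = (\<lambda>X\<in>?E. Rep_l1_real (P s (Abs_l1_real X)))" for s
  have T: "T s (Rep_l1_real v) = Rep_l1_real (P s v)" if "v \<in> E" for s v
    using that by (simp add: T_def Rep_l1_real_inverse)
  have inverse: "T (inv s) (T s X) = X" "T s (T (inv s) X) = X" if "s \<in> carrier G" "X \<in> ?E" for s X
    using that closed one by (auto simp: T simp flip: mult)
  have T_closed: "T s X \<in> ?E" if "s \<in> carrier G" "X \<in> ?E" for s X
    using that closed by (auto simp: T)
  have bij: "bij_betw (T s) ?E ?E" if "s \<in> carrier G" for s
    by (rule bij_betw_byWitness[where f' = "T (inv s)"]) (use that inverse T_closed in auto)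
  have Bij: "T s \<in> Bij ?E" if "s \<in> carrier G" for s
    using bij[OF that] by (simp add: Bij_def T_def)
  \<comment> \<open>The set-theoretic inverse is the action of \<open>inv s\<close>, so its
    boundedness is again an instance of \<open>bound\<close>, with the same
    \<open>K\<close>.\<close>
  have inv_T: "inv_into ?E (T s) X = T (inv s) X" if s: "s \<in> carrier G" and X: "X \<in> ?E" for s X
    by (rule inv_into_f_eq) (use bij[OF s] inverse[OF s X] T_closed[OF inv_closed[OF s] X] in \<open>auto simp: bij_betw_def\<close>)
  have "T s \<in> carrier (GL ?V)" if s: "s \<in> carrier G" for s
  proof -
    have "bounded_linear_op ?V (T s)"
      by (rule bounded_linear_op_Rep_l1_real[where P = "P s" and K = K])
        (use s T closed add scale bound E in auto)
    moreover have "bounded_linear_op ?V (inv_into ?E (T s))"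
      by (rule bounded_linear_op_Rep_l1_real[where P = "P (inv s)" and K = K])
        (use s T inv_T closed add scale bound E in auto)
    ultimately show ?thesis using Bij[OF s] by (simp add: GL_def)
  qed
  moreover have "T (s \<otimes> t) = T s \<otimes>\<^bsub>GL ?V\<^esub> T t" if st: "s \<in> carrier G" "t \<in> carrier G" for s t
  proof -
    have "T (s \<otimes> t) X = compose ?E (T s) (T t) X" for X
    proof (cases "X \<in> ?E")
      case True
      then show ?thesis using st closed by (auto simp: compose_eq T mult)
    next
      case False
      then show ?thesis by (auto simp: T_def compose_def)
    qed
    then show ?thesis using Bij st by (auto simp: GL_def BijGroup_def)
  qed
  ultimately show ?thesis unfolding T_def by (intro homI)
qed

lemma unitary_op_linear: "unitary_op U \<Longrightarrow> linear U"
  unfolding unitary_op_def by (intro linearI) (auto simp flip: scaleC_of_real)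

lemma unitary_op_norm: "unitary_op U \<Longrightarrow> norm (U x) = norm x"
  by (simp add: unitary_op_def norm_eq_sqrt_inner flip: Re_cinner)

theorem theorem1p5:
  fixes G :: "('g, 'm) monoid_scheme"
  assumes "group G" and "countable (carrier G)"
    and "a_TTT_menable TYPE('h::complex_hilbert) G"
  shows "\<exists>(M :: real measure) E \<sigma>.
    closed_subspace E (L1 M) \<and>
    affine_action G (L1 M\<lparr>carrier := E\<rparr>) \<sigma> \<and>
    uniformly_Lipschitz_action G (L1 M\<lparr>carrier := E\<rparr>) \<sigma> \<and>
    proper_action G (L1 M\<lparr>carrier := E\<rparr>) \<sigma>"
proof -
  interpret group G by fact
  obtain b :: "'g \<Rightarrow> 'h" where b: "wq_cocycle G b" "proper_map_on_group G b"
    using assms(3) unfolding a_TTT_menable_def by blast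
  then obtain U :: "'g \<Rightarrow> 'h \<Rightarrow> 'h" and C where U: "\<And>s. s \<in> carrier G \<Longrightarrow> unitary_op (U s)"
    and C: "\<And>s t. s \<in> carrier G \<Longrightarrow> t \<in> carrier G \<Longrightarrow> norm (b (s \<otimes>\<^bsub>G\<^esub> t) - U s (b t) - b s) \<le> C"
    unfolding wq_cocycle_def bdd_above_def by fast
  obtain \<Phi> :: "'g \<Rightarrow> l1_real" where
    upper: "\<And>(F :: 'g set) h f. finite F \<Longrightarrow> inj_on h F \<Longrightarrow> h ` F \<subseteq> carrier G \<Longrightarrow>
      norm (\<Sum>x\<in>F. f x *\<^sub>R \<Phi> (h x)) \<le> norm (\<Sum>x\<in>F. f x *\<^sub>R b (h x)) + (\<Sum>x\<in>F. \<bar>f x\<bar>)"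
    and lower: "\<And>(F :: 'g set) h f. finite F \<Longrightarrow> inj_on h F \<Longrightarrow> h ` F \<subseteq> carrier G \<Longrightarrow>
      norm (\<Sum>x\<in>F. f x *\<^sub>R b (h x)) / 4 + (\<Sum>x\<in>F. \<bar>f x\<bar>) \<le> norm (\<Sum>x\<in>F. f x *\<^sub>R \<Phi> (h x))"
    by (rule ex_l1_real_representation[OF assms(2), of b]) (rule that)
  \<comment> \<open>The 4 is the loss in \<open>lower\<close> on the Hilbert space part. In
    \<open>1 + C\<close>, which multiplies the sum of the \<open>\<bar>f x\<bar>\<close>, the 1
    comes from \<open>upper\<close> and \<open>C\<close> from the defect of the cocycle.\<close>
  define K where "K = max 4 (1 + C)"
  have K: "K \<ge> 4" "K \<ge> 1 + C" by (simp_all add: K_def)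
  define E where "E = closure (span ((\<lambda>x. \<Phi> x - \<Phi> \<one>\<^bsub>G\<^esub>) ` carrier G))"
  have E: "subspace E" "closed E"
    unfolding E_def by (simp_all add: subspace_closure)
  have ge: "(\<Sum>x\<in>F. \<bar>f x\<bar>) \<le> norm (\<Sum>x\<in>F. f x *\<^sub>R \<Phi> x)"
    if "finite F" "F \<subseteq> carrier G" for F f
  proof -
    have "0 \<le> norm (\<Sum>x\<in>F. f x *\<^sub>R b x) / 4" by simp
    also have "\<dots> + (\<Sum>x\<in>F. \<bar>f x\<bar>) \<le> norm (\<Sum>x\<in>F. f x *\<^sub>R \<Phi> x)"
      using lower[of F "\<lambda>x. x" f] that by simp
    finally show ?thesis by simp
  qed
  have shift: "norm (\<Sum>x\<in>F. f x *\<^sub>R \<Phi> (s \<otimes>\<^bsub>G\<^esub> x)) \<le> K * norm (\<Sum>x\<in>F. f x *\<^sub>R \<Phi> x)"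
    if s: "s \<in> carrier G" and F: "finite F" "F \<subseteq> carrier G" "sum f F = 0" for s F f
  proof -
    \<comment> \<open>\<open>?c x\<close> is the defect at the pair of \<open>s\<close> and
      \<open>x\<close>, of norm at most \<open>C\<close>.\<close>
    let ?c = "\<lambda>x. b (s \<otimes>\<^bsub>G\<^esub> x) - U s (b x) - b s" and ?v = "\<Sum>x\<in>F. f x *\<^sub>R b x"
    have "(\<Sum>x\<in>F. f x *\<^sub>R b (s \<otimes>\<^bsub>G\<^esub> x)) =
        (\<Sum>x\<in>F. U s (f x *\<^sub>R b x) + f x *\<^sub>R b s + f x *\<^sub>R ?c x)"
      by (simp add: linear_scale[OF unitary_op_linear[OF U[OF s]]] algebra_simps)
    also have "\<dots> = U s ?v + sum f F *\<^sub>R b s + (\<Sum>x\<in>F. f x *\<^sub>R ?c x)"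
      by (simp add: sum.distrib linear_sum[OF unitary_op_linear[OF U[OF s]]] scaleR_sum_left)
    finally have "norm (\<Sum>x\<in>F. f x *\<^sub>R b (s \<otimes>\<^bsub>G\<^esub> x)) \<le> norm ?v + norm (\<Sum>x\<in>F. f x *\<^sub>R ?c x)"
      using norm_triangle_ineq[of "U s ?v"] F(3) by (simp add: unitary_op_norm[OF U[OF s]])
    moreover have "norm (\<Sum>x\<in>F. f x *\<^sub>R ?c x) \<le> (\<Sum>x\<in>F. \<bar>f x\<bar>) * C"
      unfolding sum_distrib_right using C s F(2) by (intro sum_norm_le) (auto intro!: mult_left_mono)
    moreover have "inj_on ((\<otimes>\<^bsub>G\<^esub>) s) F"
      using s F(2) by (intro inj_onI) (auto simp: subset_iff)
    then have "norm (\<Sum>x\<in>F. f x *\<^sub>R \<Phi> (s \<otimes>\<^bsub>G\<^esub> x)) \<le>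
        norm (\<Sum>x\<in>F. f x *\<^sub>R b (s \<otimes>\<^bsub>G\<^esub> x)) + (\<Sum>x\<in>F. \<bar>f x\<bar>)"
      using s F by (intro upper) auto
    ultimately have "norm (\<Sum>x\<in>F. f x *\<^sub>R \<Phi> (s \<otimes>\<^bsub>G\<^esub> x)) \<le> norm ?v + (1 + C) * (\<Sum>x\<in>F. \<bar>f x\<bar>)"
      unfolding distrib_right mult.commute[of C] by linarith
    \<comment> \<open>Arranged to match the left side of \<open>lower\<close>:
      \<open>K \<ge> 4\<close> absorbs the division by 4.\<close>
    also have "\<dots> \<le> K * (norm ?v / 4) + K * (\<Sum>x\<in>F. \<bar>f x\<bar>)"
      using K mult_right_mono[OF K(1) norm_ge_zero[of ?v]]
      by (intro add_mono mult_right_mono sum_nonneg) auto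
    also have "\<dots> \<le> K * norm (\<Sum>x\<in>F. f x *\<^sub>R \<Phi> x)"
      unfolding distrib_left[symmetric] using K(1) lower[of F "\<lambda>x. x" f] F
      by (intro mult_left_mono) auto
    finally show ?thesis .
  qed
  obtain P where P:
    "\<And>s v. s \<in> carrier G \<Longrightarrow> v \<in> E \<Longrightarrow> P s v \<in> E"
    "\<And>s v w. s \<in> carrier G \<Longrightarrow> v \<in> E \<Longrightarrow> w \<in> E \<Longrightarrow> P s (v + w) = P s v + P s w"
    "\<And>s c v. s \<in> carrier G \<Longrightarrow> v \<in> E \<Longrightarrow> P s (c *\<^sub>R v) = c *\<^sub>R P s v"
    "\<And>s v. s \<in> carrier G \<Longrightarrow> v \<in> E \<Longrightarrow> norm (P s v) \<le> K * norm v"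
    "\<And>s t v. s \<in> carrier G \<Longrightarrow> t \<in> carrier G \<Longrightarrow> v \<in> E \<Longrightarrow> P (s \<otimes>\<^bsub>G\<^esub> t) v = P s (P t v)"
    "\<And>v. v \<in> E \<Longrightarrow> P \<one>\<^bsub>G\<^esub> v = v"
    "\<And>s x. s \<in> carrier G \<Longrightarrow> x \<in> carrier G \<Longrightarrow> P s (\<Phi> x - \<Phi> \<one>\<^bsub>G\<^esub>) = \<Phi> (s \<otimes>\<^bsub>G\<^esub> x) - \<Phi> s"
    by (rule shift_extends_to_closed_span[where \<Phi> = \<Phi> and K = K, OF assms(1), folded E_def])
      (erule (1) ge, erule (3) shift, rule that)
  \<comment> \<open>Formally the coboundary of \<open>\<Phi> \<one>\<close>, but only differences of
    the \<open>\<Phi> s\<close> are known to lie in \<open>E\<close>.\<close>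
  define \<beta> where "\<beta> s = \<Phi> s - \<Phi> \<one>\<^bsub>G\<^esub>" for s
  have \<beta>_E: "\<beta> s \<in> E" if "s \<in> carrier G" for s
    unfolding E_def \<beta>_def using that by (intro subsetD[OF closure_subset] span_base) auto
  have \<beta>_mult: "\<beta> (s \<otimes>\<^bsub>G\<^esub> t) = P s (\<beta> t) + \<beta> s" if "s \<in> carrier G" "t \<in> carrier G" for s t
    using P(7)[OF that] by (simp add: \<beta>_def)
  \<comment> \<open>Properness passes from \<open>b\<close> to \<open>\<beta>\<close> by applying
    \<open>lower\<close> to the coefficients 1 at \<open>s\<close> and -1 at the identity. These two
    points coincide for \<open>s = \<one>\<close>, which is therefore a separate case.\<close>
  have \<beta>_norm: "norm (b s) \<le> norm (b \<one>\<^bsub>G\<^esub>) + 4 * norm (\<beta> s)" if s: "s \<in> carrier G" for s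
  proof (cases "s = \<one>\<^bsub>G\<^esub>")
    case False
    have "norm (b s - b \<one>\<^bsub>G\<^esub>) / 4 \<le> norm (\<beta> s)"
      using lower[of "{s, \<one>\<^bsub>G\<^esub>}" "\<lambda>x. x" "\<lambda>x. if x = s then 1 else -1"] s False
      by (simp add: \<beta>_def)
    then show ?thesis using norm_triangle_sub[of "b s" "b \<one>\<^bsub>G\<^esub>"] by simp
  qed simp
  let ?V = "subspace_l1 E"
  define \<pi> where "\<pi> s = (\<lambda>X\<in>Rep_l1_real ` E. Rep_l1_real (P s (Abs_l1_real X)))" for s
  define \<sigma> where "\<sigma> s X = vadd ?V (\<pi> s X) (Rep_l1_real (\<beta> s))" for s X
  have \<pi>: "\<pi> s (Rep_l1_real v) = Rep_l1_real (P s v)" if "v \<in> E" for s v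
    using that by (simp add: \<pi>_def Rep_l1_real_inverse)
  have \<sigma>: "\<sigma> s (Rep_l1_real v) = Rep_l1_real (P s v + \<beta> s)" if "v \<in> E" for s v
    using that by (simp add: \<sigma>_def \<pi> Rep_l1_real_add)
  have vdist: "vdist ?V (Rep_l1_real v) (Rep_l1_real w) = dist v w" for v w
    using vdist_Rep_l1_real[of v w] by (simp add: vdist_def)
  have "affine_action G ?V \<sigma>"
    unfolding affine_action_def
  proof (intro bexI[of _ \<pi>] bexI[of _ "\<lambda>s. Rep_l1_real (\<beta> s)"] conjI ballI)
    show "\<pi> \<in> hom G (GL ?V)"
      unfolding \<pi>_def by (rule linear_action_hom_GL[OF assms(1) E(1) P(1-6)])
    show "(\<lambda>s. Rep_l1_real (\<beta> s)) \<in> carrier G \<rightarrow> carrier ?V"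
      using \<beta>_E by auto
    show "Rep_l1_real (\<beta> (s \<otimes>\<^bsub>G\<^esub> t)) = vadd ?V (\<pi> s (Rep_l1_real (\<beta> t))) (Rep_l1_real (\<beta> s))"
      if "s \<in> carrier G" "t \<in> carrier G" for s t
      using that by (simp add: \<pi> \<beta>_E \<beta>_mult Rep_l1_real_add)
  qed (simp add: \<sigma>_def)
  moreover have "uniformly_Lipschitz_action G ?V \<sigma>"
    unfolding uniformly_Lipschitz_action_def
  proof (intro exI[of _ K] conjI ballI)
    show "K \<ge> 1" using K(1) by simp
    fix s X Y assume s: "s \<in> carrier G" and "X \<in> carrier ?V" "Y \<in> carrier ?V"
    then obtain v w where vw: "v \<in> E" "w \<in> E" "X = Rep_l1_real v" "Y = Rep_l1_real w" by auto
    have "P s (v - w) = P s v - P s w"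
      using P(2)[OF s vw(1), of "(-1) *\<^sub>R w"] P(3)[OF s vw(2), of "-1"] subspace_scale[OF E(1) vw(2), of "-1"]
      by simp
    then have "dist (P s v + \<beta> s) (P s w + \<beta> s) \<le> K * dist v w"
      using P(4)[OF s subspace_diff[OF E(1) vw(1,2)]] by (simp add: dist_norm)
    then show "vdist ?V (\<sigma> s X) (\<sigma> s Y) \<le> K * vdist ?V X Y"
      using vw by (simp add: \<sigma> vdist)
  qed
  moreover have "proper_action G ?V \<sigma>"
    unfolding proper_action_def
  proof (intro ballI allI impI)
    fix X and R :: real assume "X \<in> carrier ?V" and R: "R > 0"
    then obtain v where v: "v \<in> E" "X = Rep_l1_real v" by auto
    \<comment> \<open>The displacement of \<open>v\<close> differs from \<open>\<beta> s\<close> by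
      \<open>P s v - v\<close>, of norm at most \<open>(K + 1) * norm v\<close>. Thus
      \<open>\<beta> s\<close> has norm at most \<open>R + (K + 1) * norm v\<close>, and
      \<open>\<beta>_norm\<close> bounds \<open>b s\<close> by \<open>r\<close>.\<close>
    define r where "r = norm (b \<one>\<^bsub>G\<^esub>) + 4 * (R + (K + 1) * norm v)"
    have "norm (b s) \<le> r" if s: "s \<in> carrier G" and "vdist ?V (\<sigma> s X) X \<le> R" for s
    proof -
      have "norm (P s v + \<beta> s - v) \<le> R"
        using that v by (simp add: \<sigma> vdist dist_norm)
      moreover have "norm (\<beta> s) \<le> norm (P s v + \<beta> s - v) + norm (P s v - v)"
        using norm_triangle_ineq4[of "P s v + \<beta> s - v" "P s v - v"] by (simp add: algebra_simps)
      moreover have "norm (P s v - v) \<le> K * norm v + norm v"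
        using norm_triangle_ineq4[of "P s v" v] P(4)[OF s v(1)] by simp
      ultimately have "norm (\<beta> s) \<le> R + (K + 1) * norm v"
        by (simp add: algebra_simps)
      then show ?thesis using \<beta>_norm[OF s] by (simp add: r_def)
    qed
    then have "{s \<in> carrier G. vdist ?V (\<sigma> s X) X \<le> R} \<subseteq> {s \<in> carrier G. norm (b s) \<le> r}"
      by blast
    \<comment> \<open>Positivity of \<open>r\<close> is checked because
      \<open>proper_map_on_group\<close> speaks of positive radii only.\<close>
    moreover have "0 \<le> (K + 1) * norm v" using K(1) by simp
    then have "r > 0"
      unfolding r_def using R by (intro add_nonneg_pos mult_pos_pos add_pos_nonneg) auto
    then have "finite {s \<in> carrier G. norm (b s) \<le> r}"
      using b(2) by (simp add: proper_map_on_group_def)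
    ultimately show "finite {s \<in> carrier G. vdist ?V (\<sigma> s X) X \<le> R}"
      by (rule finite_subset)
  qed
  ultimately show ?thesis
    using closed_subspace_Rep_l1_real[OF E] by blast
qed

end
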